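(* Let $p,q>1$ satisfy $\frac1p+\frac1q=1$, and let $f\in\mathcal E^p$, $g\in\mathcal E^q$. For $N,M\ge0$, consider the continuous piecewise linear functions $\Pi_Nf$ and $\Pi_Mg$ (finite Faber--Schauder truncations). Then $$\sup_{t\in[0,1]}\left|\int_0^t\Pi_Nf\,d(\Pi_Mg)-I_{f,g}(t)\right|\xrightarrow{N,M\to\infty}0,$$ where the integral on the left-hand side is the classical Riemann--Stieltjes integral and $I_{f,g}$ is the Faber--Schauder integral of $f$ against $g$.
   Context: $C([0,1])$ denotes the real-valued continuous functions on $[0,1]$, $\|\cdot\|_\infty$ the uniform norm. $\mathbb N_0=\{0,1,2,\dots\}$, $\mathbb N_{-1}=\{-1,0,1,\dots\}$. For $n\in\mathbb N_0$: $t_{n,k}=k2^{-n}$ for $0\le k\le 2^n$, $\mathbb T_n=\{t_{n,k}:0\le k\le 2^n\}$, $\mathbb T=\bigcup_{n\ge0}\mathbb T_n$, $I_n=\{0,\dots,2^n-1\}$; also $I_{-1}=\{0\}$; for $t\in\mathbb T$, $\ell(t)=\min\{m\ge0:t\in\mathbb T_m\}$. Dyadic left sums: for $f,g\in C([0,1])$, $t\in\mathbb T$, $n\ge\ell(t)$, $$S_n^L(t;f,g)=\sum_{k=0}^{2^nt-1}f(t_{n,k})\big(g(t_{n,k+1})-g(t_{n,k})\big)$$ (empty sum $=0$). The dyadic integral over $[0,t]$ exists if $(S_n^L(t;f,g))_{n\ge\ell(t)}$ converges, and its limit is denoted $I^{\mathbb T}_{f,g}(t)$. Faber--Schauder integral: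 if $I^{\mathbb T}_{f,g}(t)$ exists for every $t\in\mathbb T$ and the map $I^{\mathbb T}_{f,g}:\mathbb T\to\mathbb R$ admits a (necessarily unique) continuous extension to $[0,1]$, this extension is denoted $I_{f,g}:[0,1]\to\mathbb R$ and one says that the Faber--Schauder integral $I_{f,g}$ exists on $[0,1]$. (It exists when $f\in\mathcal E^p$, $g\in\mathcal E^q$ with $\frac1p+\frac1q=1$.) Haar and Faber--Schauder functions: $\psi=1$ on $[0,\frac12)$, $\psi=-1$ on $[\frac12,1)$, $\psi=0$ otherwise; $\psi_{n,k}(t)=2^{n/2}\psi(2^nt-k)$ for $n\ge0$, $k\in I_n$; $\psi_{-1,0}(t)=1$ on $[0,1]$; $e_{n,k}(t)=\int_0^t\psi_{n,k}(s)\,ds$. Faber--Schauder coefficients of $f\in C([0,1])$: $\theta^f_{-1,0}=f(1)-f(0)$, and for $n\ge0$, $k\in I_n$, $\theta^f_{n,k}=2^{n/2}\big(2f(t_{n+1,2k+1})-f(t_{n,k})-f(t_{n,k+1})\big)$. Truncation: $\Pi_Nf(t)=f(0)+\sum_{n=-1}^{N-1}\sum_{k\in I_n}\theta^f_{n,k}e_{n,k}(t)$. Level energies ($p>1$): $\zeta_f^{(p)}(-1)=2^{1-\frac1p}|\theta^f_{-1,0}|$ and $\zeta_f^{(p)}(n)=\big(2^{-np/2}\sum_{k\in I_n}|\theta^f_{n,k}|^p\big)^{1/p}$ for $n\ge0$. Schauder tail sequence: $H_f(n)=\sum_{m=n}^\infty 2^{-m/2}\sup_{k\in I_m}|\theta^f_{m,k}|\in[0,\infty]$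 for $n\ge0$. Energy space ($p>1$): $\|f\|_{\mathcal E^p}=\|f\|_\infty+\|\zeta_f^{(p)}\|_{\ell^p(\mathbb N_{-1})}+\|H_f\|_{\ell^p(\mathbb N_0)}$ and $\mathcal E^p=\{f\in C([0,1]):\|f\|_{\mathcal E^p}<\infty\}$. *)

theory Defs
  imports "HOL-Analysis.Analysis"
begin

text \<open>
  Elements of $C([0,1])$ are functions \<open>real \<Rightarrow> real\<close> that are continuous on \<open>{0..1}\<close>; every notion
  below only looks at the values on \<open>{0..1}\<close>.  Levels of coefficients and of Haar functions are
  integers \<open>n \<ge> -1\<close>; levels of dyadic grids are naturals.
\<close>

definition dyadic_pt :: "nat \<Rightarrow> nat \<Rightarrow> real" where
  "dyadic_pt n k = real k / 2 ^ n"

definition dyadic_grid :: "nat \<Rightarrow> real set" where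
  "dyadic_grid n = dyadic_pt n ` {0..2 ^ n}"

definition dyadics :: "real set" where
  "dyadics = (\<Union>n. dyadic_grid n)"

definition dyadic_level :: "real \<Rightarrow> nat" where
  "dyadic_level t = (LEAST m. t \<in> dyadic_grid m)"

definition level_idx :: "int \<Rightarrow> nat set" where
  "level_idx n = (if n = -1 then {0} else {..<2 ^ nat n})"


subsection \<open>Dyadic and Faber--Schauder integrals\<close>

text \<open>Only used for \<open>t \<in> dyadic_grid n\<close>, where the floor is exact.\<close>

definition left_sum :: "(real \<Rightarrow> real) \<Rightarrow> (real \<Rightarrow> real) \<Rightarrow> real \<Rightarrow> nat \<Rightarrow> real" where
  "left_sum f g t n =
     (\<Sum>k<nat \<lfloor>2 ^ n * t\<rfloor>. f (dyadic_pt n k) * (g (dyadic_pt n (Suc k)) - g (dyadic_pt n k)))"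

text \<open>The sequence of left sums over \<open>n \<ge> dyadic_level t\<close>, re-indexed to start at 0.\<close>

definition dyadic_sums :: "(real \<Rightarrow> real) \<Rightarrow> (real \<Rightarrow> real) \<Rightarrow> real \<Rightarrow> nat \<Rightarrow> real" where
  "dyadic_sums f g t = (\<lambda>i. left_sum f g t (dyadic_level t + i))"

definition dyadic_integrable :: "(real \<Rightarrow> real) \<Rightarrow> (real \<Rightarrow> real) \<Rightarrow> real \<Rightarrow> bool" where
  "dyadic_integrable f g t \<longleftrightarrow> convergent (dyadic_sums f g t)"

definition dyadic_integral :: "(real \<Rightarrow> real) \<Rightarrow> (real \<Rightarrow> real) \<Rightarrow> real \<Rightarrow> real" where
  "dyadic_integral f g t = lim (dyadic_sums f g t)"

definition has_fs_integral ::
    "(real \<Rightarrow> real) \<Rightarrow> (real \<Rightarrow> real) \<Rightarrow> (real \<Rightarrow> real) \<Rightarrow> bool" where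
  "has_fs_integral f g F \<longleftrightarrow>
     (\<forall>t\<in>dyadics. dyadic_integrable f g t) \<and>
     continuous_on {0..1} F \<and> (\<forall>t\<in>dyadics. F t = dyadic_integral f g t)"

definition fs_integrable :: "(real \<Rightarrow> real) \<Rightarrow> (real \<Rightarrow> real) \<Rightarrow> bool" where
  "fs_integrable f g \<longleftrightarrow> (\<exists>F. has_fs_integral f g F)"

text \<open>By density of \<open>dyadics\<close> the chosen function is unique on \<open>{0..1}\<close>; outside it is arbitrary,
  hence \<open>SOME\<close> rather than \<open>THE\<close>.\<close>

definition fs_integral :: "(real \<Rightarrow> real) \<Rightarrow> (real \<Rightarrow> real) \<Rightarrow> real \<Rightarrow> real" where
  "fs_integral f g = (SOME F. has_fs_integral f g F)"


subsection \<open>Haar and Faber--Schauder functions\<close>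

definition haar_mother :: "real \<Rightarrow> real" where
  "haar_mother t = (if 0 \<le> t \<and> t < 1/2 then 1 else if 1/2 \<le> t \<and> t < 1 then -1 else 0)"

definition haar :: "int \<Rightarrow> nat \<Rightarrow> real \<Rightarrow> real" where
  "haar n k t =
     (if n = -1 then indicator {0..1} t
      else 2 powr (real_of_int n / 2) * haar_mother (2 ^ nat n * t - real k))"

definition schauder :: "int \<Rightarrow> nat \<Rightarrow> real \<Rightarrow> real" where
  "schauder n k t = integral {0..t} (haar n k)"

definition fs_coeff :: "(real \<Rightarrow> real) \<Rightarrow> int \<Rightarrow> nat \<Rightarrow> real" where
  "fs_coeff f n k =
     (if n = -1 then f 1 - f 0
      else 2 powr (real_of_int n / 2) *
        (2 * f (dyadic_pt (Suc (nat n)) (2 * k + 1))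
           - f (dyadic_pt (nat n) k) - f (dyadic_pt (nat n) (Suc k))))"

definition fs_trunc :: "nat \<Rightarrow> (real \<Rightarrow> real) \<Rightarrow> real \<Rightarrow> real" where
  "fs_trunc N f t =
     f 0 + (\<Sum>n\<in>{-1..int N - 1}. \<Sum>k\<in>level_idx n. fs_coeff f n k * schauder n k t)"


subsection \<open>Energy spaces\<close>

text \<open>Power with exponent \<open>p > 0\<close> on $[0,\infty]$, with $\infty^p = \infty$.\<close>

definition epowr :: "ennreal \<Rightarrow> real \<Rightarrow> ennreal" where
  "epowr x p = (if x = \<infinity> then \<infinity> else ennreal (enn2real x powr p))"

definition lp_norm :: "real \<Rightarrow> 'i set \<Rightarrow> ('i \<Rightarrow> ennreal) \<Rightarrow> ennreal" where
  "lp_norm p A a = epowr (\<Sum>\<^sub>\<infinity>n\<in>A. epowr (a n) p) (1 / p)"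

definition level_energy :: "real \<Rightarrow> (real \<Rightarrow> real) \<Rightarrow> int \<Rightarrow> real" where
  "level_energy p f n =
     (if n = -1 then 2 powr (1 - 1 / p) * \<bar>fs_coeff f (-1) 0\<bar>
      else (2 powr (- (real_of_int n * p / 2)) *
              (\<Sum>k\<in>level_idx n. \<bar>fs_coeff f n k\<bar> powr p)) powr (1 / p))"

definition schauder_tail :: "(real \<Rightarrow> real) \<Rightarrow> nat \<Rightarrow> ennreal" where
  "schauder_tail f n =
     (\<Sum>\<^sub>\<infinity>m\<in>{n..}. ennreal (2 powr (- (real m / 2))) *
        (SUP k\<in>level_idx (int m). ennreal \<bar>fs_coeff f (int m) k\<bar>))"

definition energy_norm :: "real \<Rightarrow> (real \<Rightarrow> real) \<Rightarrow> ennreal" where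
  "energy_norm p f =
     (SUP t\<in>{0..1}. ennreal \<bar>f t\<bar>)
     + lp_norm p {-1..} (\<lambda>n. ennreal (level_energy p f n))
     + lp_norm p UNIV (schauder_tail f)"

definition energy_space :: "real \<Rightarrow> (real \<Rightarrow> real) set" where
  "energy_space p = {f. continuous_on {0..1} f \<and> energy_norm p f < \<infinity>}"


subsection \<open>The classical Riemann--Stieltjes integral\<close>

text \<open>Limit of the sums $\sum f(\xi_i)\,(g(x_{i+1}) - g(x_i))$ as the mesh tends to 0, for arbitrary
  tags.  Degenerate intervals, which \<open>tagged_division_of\<close> permits, contribute 0.\<close>

definition has_rs_integral ::
    "(real \<Rightarrow> real) \<Rightarrow> (real \<Rightarrow> real) \<Rightarrow> real \<Rightarrow> real \<Rightarrow> real \<Rightarrow> bool" where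
  "has_rs_integral f g a b I \<longleftrightarrow>
     (\<forall>\<epsilon>>0. \<exists>\<delta>>0. \<forall>D. D tagged_division_of {a..b} \<and> (\<forall>(x, K)\<in>D. Sup K - Inf K < \<delta>) \<longrightarrow>
        \<bar>(\<Sum>(x, K)\<in>D. f x * (g (Sup K) - g (Inf K))) - I\<bar> < \<epsilon>)"

definition rs_integrable :: "(real \<Rightarrow> real) \<Rightarrow> (real \<Rightarrow> real) \<Rightarrow> real \<Rightarrow> real \<Rightarrow> bool" where
  "rs_integrable f g a b \<longleftrightarrow> (\<exists>I. has_rs_integral f g a b I)"

definition rs_integral :: "(real \<Rightarrow> real) \<Rightarrow> (real \<Rightarrow> real) \<Rightarrow> real \<Rightarrow> real \<Rightarrow> real" where
  "rs_integral f g a b = (THE I. has_rs_integral f g a b I)"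

end

theory Submission imports Defs
begin

text \<open>
  Split \<open>f\<close> and \<open>g\<close> into blocks, one for each level of their Faber--Schauder expansions: write
  \<open>U j\<close> and \<open>V i\<close> for the blocks of level \<open>j - 1\<close> of \<open>f\<close> and level \<open>i - 1\<close> of \<open>g\<close>.  They are piecewise
  affine, so the Riemann--Stieltjes integral of one truncation against another is the ordinary
  integral against the derivative (\<open>rs_integral_pw_primitive\<close>), and up to the contribution of the
  constant \<open>f 0\<close> it is the sum of the integrals \<open>a j i t\<close> of \<open>U j\<close> against \<open>V i\<close> over \<open>[0, t]\<close>, for \<open>j \<le> N\<close> and \<open>i \<le> M\<close>.
  The theorem follows once these integrals are summable over all pairs of levels, uniformly in \<open>t\<close>.

  Two facts give the decay.  A block is pointwise at most \<open>1 / 2 ^ j\<close> times the modulus of its derivative,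
  and the level energy is a rescaled $L^p$ norm of that derivative
  (\<open>haar_block_powr_has_integral\<close>).  Young's inequality then bounds \<open>a j i t\<close>, for \<open>i \<le> j\<close>, by a power of a number
  \<open>r < 1\<close> with exponent \<open>j - i\<close>, times the sum of the \<open>p\<close>-th power of the energy of \<open>f\<close> and the \<open>q\<close>-th power
  of the energy of \<open>g\<close> at these levels.  For \<open>i > j\<close> integration by parts exchanges the roles of \<open>f\<close> and \<open>g\<close>
  and leaves the boundary term \<open>U j t * V i t\<close>, which is summable because finite Schauder tails
  make the uniform norms of the blocks summable (\<open>abs_block_integral_bound\<close>).  The resulting bounds are summable over
  all pairs (\<open>summable_on_block_bounds\<close>), and the Weierstrass test gives a uniform, hence continuous, limit \<open>F\<close>.

  It remains to identify \<open>F\<close> with the Faber--Schauder integral.  The truncation with blocks up to \<open>n\<close>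
  interpolates at the grid of level \<open>n\<close>, so the left sum at that level differs from the integral of the diagonal
  truncations only through the oscillation of an affine function on each cell.  This error is at most the
  integral of the product of the moduli of the two derivatives, divided by \<open>2 ^ n\<close>; by the same Young bound it
  is controlled by convolutions of summable sequences with a geometric sequence and tends to 0
  (\<open>energy_of_sums_null\<close>).  So the left sums converge to \<open>F\<close> at dyadic points, and continuity
  makes \<open>F\<close> the Faber--Schauder integral on all of \<open>[0, 1]\<close>.
\<close>

section \<open>Primitives of bounded functions and Riemann--Stieltjes integrals\<close>

text \<open>
  Truncations and their blocks are primitives, off finitely many points, of bounded step functions.
  The predicate keeps exactly what is used about such a pair: the fundamental theorem of calculus,
  and integrability of a continuous function times the derivative.  The derivative is a chosen
  everywhere defined representative, because its values at the breakpoints enter pointwise bounds.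
\<close>
definition pw_primitive :: "(real \<Rightarrow> real) \<Rightarrow> (real \<Rightarrow> real) \<Rightarrow> bool" where
  "pw_primitive u u' \<longleftrightarrow> continuous_on {0..1} u \<and> u' \<in> borel_measurable borel \<and>
     (\<exists>B. \<forall>s. \<bar>u' s\<bar> \<le> B) \<and>
     (\<exists>S. finite S \<and> (\<forall>x\<in>{0<..<1} - S. (u has_real_derivative u' x) (at x)))"

lemma pw_primitive_continuous: "pw_primitive u u' \<Longrightarrow> continuous_on {0..1} u"
  by (simp add: pw_primitive_def)

lemma pw_primitive_measurable: "pw_primitive u u' \<Longrightarrow> u' \<in> borel_measurable borel"
  by (simp add: pw_primitive_def)

lemma pw_primitive_const: "pw_primitive (\<lambda>_. c) (\<lambda>_. 0)"
  unfolding pw_primitive_def by (auto intro!: continuous_intros exI[of _ "{}"])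

lemma pw_primitive_cmult:
  assumes "pw_primitive u u'"
  shows "pw_primitive (\<lambda>s. c * u s) (\<lambda>s. c * u' s)"
proof -
  obtain B S where B: "\<And>s. \<bar>u' s\<bar> \<le> B" and S: "finite S"
    and d: "\<And>x. x \<in> {0<..<1} - S \<Longrightarrow> (u has_real_derivative u' x) (at x)"
    using assms unfolding pw_primitive_def by blast
  have "\<forall>s. \<bar>c * u' s\<bar> \<le> \<bar>c\<bar> * B"
    using B by (auto simp: abs_mult intro: mult_left_mono)
  moreover have "\<forall>x\<in>{0<..<1} - S. ((\<lambda>s. c * u s) has_real_derivative c * u' x) (at x)"
    using d by (auto intro!: DERIV_cmult)
  ultimately show ?thesis
    using assms S unfolding pw_primitive_def
    by (auto intro!: continuous_intros)
qed

lemma pw_primitive_add: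
  assumes "pw_primitive u u'" "pw_primitive v v'"
  shows "pw_primitive (\<lambda>s. u s + v s) (\<lambda>s. u' s + v' s)"
proof -
  obtain B S where B: "\<And>s. \<bar>u' s\<bar> \<le> B" and S: "finite S"
    and d: "\<And>x. x \<in> {0<..<1} - S \<Longrightarrow> (u has_real_derivative u' x) (at x)"
    using assms(1) unfolding pw_primitive_def by blast
  obtain C T where C: "\<And>s. \<bar>v' s\<bar> \<le> C" and T: "finite T"
    and e: "\<And>x. x \<in> {0<..<1} - T \<Longrightarrow> (v has_real_derivative v' x) (at x)"
    using assms(2) unfolding pw_primitive_def by blast
  have "\<forall>s. \<bar>u' s + v' s\<bar> \<le> B + C"
    using B C abs_triangle_ineq by (meson add_mono order_trans)
  moreover have "finite (S \<union> T) \<and>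
      (\<forall>x\<in>{0<..<1} - (S \<union> T). ((\<lambda>s. u s + v s) has_real_derivative u' x + v' x) (at x))"
    using S T d e by (auto intro!: DERIV_add)
  ultimately show ?thesis
    using assms unfolding pw_primitive_def
    by (auto intro!: continuous_intros simp del: finite_Un)
qed

lemma pw_primitive_sum:
  assumes "finite A" "\<And>k. k \<in> A \<Longrightarrow> pw_primitive (u k) (u' k)"
  shows "pw_primitive (\<lambda>s. \<Sum>k\<in>A. u k s) (\<lambda>s. \<Sum>k\<in>A. u' k s)"
  using assms by (induction A) (auto intro!: pw_primitive_const pw_primitive_add)

lemma bounded_measurable_integrable_on:
  fixes w :: "real \<Rightarrow> real"
  assumes "w \<in> borel_measurable (lebesgue_on {a..b})" "\<And>x. x \<in> {a..b} \<Longrightarrow> \<bar>w x\<bar> \<le> B"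
  shows "w integrable_on {a..b}"
  by (rule measurable_bounded_by_integrable_imp_integrable[where g = "\<lambda>_. B"])
     (use assms in auto)

lemma borel_measurable_lebesgue_on:
  "(u :: real \<Rightarrow> real) \<in> borel_measurable borel \<Longrightarrow> u \<in> borel_measurable (lebesgue_on S)"
  by (simp add: measurable_completion measurable_restrict_space1)

lemma continuous_times_bounded_integrable_on:
  fixes w v :: "real \<Rightarrow> real"
  assumes w: "continuous_on {a..b} w"
    and v: "v \<in> borel_measurable borel" "\<And>s. \<bar>v s\<bar> \<le> B"
  shows "(\<lambda>s. w s * v s) integrable_on {a..b}"
proof -
  obtain C where C: "\<And>s. s \<in> {a..b} \<Longrightarrow> \<bar>w s\<bar> \<le> C"
    using continuous_on_compact_bound[OF compact_Icc w] by (metis real_norm_def)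
  show ?thesis
  proof (rule bounded_measurable_integrable_on)
    show "(\<lambda>s. w s * v s) \<in> borel_measurable (lebesgue_on {a..b})"
      by (intro borel_measurable_times continuous_imp_measurable_on_sets_lebesgue[OF w]
            borel_measurable_lebesgue_on[OF v(1)]) simp
    show "\<bar>w s * v s\<bar> \<le> C * B" if "s \<in> {a..b}" for s
      using C[OF that] v(2)[of s] by (auto simp: abs_mult intro!: mult_mono order_trans[OF abs_ge_zero])
  qed
qed

lemma pw_primitive_times_integrable_on:
  assumes "continuous_on {a..b} w" "pw_primitive v v'"
  shows "(\<lambda>s. w s * v' s) integrable_on {a..b}"
proof -
  obtain B where "\<And>s. \<bar>v' s\<bar> \<le> B" using assms(2) unfolding pw_primitive_def by blast
  then show ?thesis
    using continuous_times_bounded_integrable_on[OF assms(1) pw_primitive_measurable[OF assms(2)]] by blast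
qed

lemma pw_primitive_FTC:
  assumes "pw_primitive u u'" "0 \<le> a" "a \<le> b" "b \<le> 1"
  shows "(u' has_integral u b - u a) {a..b}"
proof -
  obtain S where S: "finite S"
    and d: "\<And>x. x \<in> {0<..<1} - S \<Longrightarrow> (u has_real_derivative u' x) (at x)"
    using assms(1) unfolding pw_primitive_def by blast
  show ?thesis
  proof (rule fundamental_theorem_of_calculus_interior_strong[OF S \<open>a \<le> b\<close>])
    show "(u has_vector_derivative u' x) (at x)" if "x \<in> {a<..<b} - S" for x
      using d[of x] that assms by (auto simp: has_real_derivative_iff_has_vector_derivative)
    show "continuous_on {a..b} u"
      using assms by (auto intro: continuous_on_subset[OF pw_primitive_continuous])
  qed
qed

lemma pw_primitive_by_parts:
  assumes u: "pw_primitive u u'" and v: "pw_primitive v v'" and "0 \<le> t" "t \<le> 1"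
  shows "integral {0..t} (\<lambda>s. u s * v' s) = u t * v t - u 0 * v 0 - integral {0..t} (\<lambda>s. v s * u' s)"
proof -
  obtain S where S: "finite S"
    and d: "\<And>x. x \<in> {0<..<1} - S \<Longrightarrow> (u has_real_derivative u' x) (at x)"
    using u unfolding pw_primitive_def by blast
  obtain T where T: "finite T"
    and e: "\<And>x. x \<in> {0<..<1} - T \<Longrightarrow> (v has_real_derivative v' x) (at x)"
    using v unfolding pw_primitive_def by blast
  have cu: "continuous_on {0..t} u" and cv: "continuous_on {0..t} v"
    using assms by (auto intro: continuous_on_subset[OF pw_primitive_continuous])
  have "((\<lambda>s. u s * v' s + v s * u' s) has_integral u t * v t - u 0 * v 0) {0..t}"
  proof (rule fundamental_theorem_of_calculus_interior_strong[of "S \<union> T"])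
    show "((\<lambda>s. u s * v s) has_vector_derivative u x * v' x + v x * u' x) (at x)"
      if "x \<in> {0<..<t} - (S \<union> T)" for x
      unfolding has_real_derivative_iff_has_vector_derivative[symmetric]
      using that assms by (auto intro!: derivative_eq_intros d e)
  qed (use S T cu cv \<open>0 \<le> t\<close> in \<open>auto intro!: continuous_intros\<close>)
  moreover have "integral {0..t} (\<lambda>s. u s * v' s + v s * u' s)
      = integral {0..t} (\<lambda>s. u s * v' s) + integral {0..t} (\<lambda>s. v s * u' s)"
    by (intro integral_add pw_primitive_times_integrable_on[OF cu v] pw_primitive_times_integrable_on[OF cv u])
  ultimately show ?thesis by (simp add: integral_unique)
qed

text \<open>
  For a positive mesh some tagged division exists (Cousin's lemma), so two candidate limits can be
  compared on a common division.  This makes the \<open>THE\<close> in \<open>rs_integral\<close> meaningful.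
\<close>
lemma has_rs_integral_unique:
  assumes I: "has_rs_integral f g a b I" and J: "has_rs_integral f g a b J"
  shows "I = J"
proof (rule ccontr)
  assume "I \<noteq> J"
  define e where "e = \<bar>I - J\<bar> / 2"
  have "e > 0" using \<open>I \<noteq> J\<close> by (simp add: e_def)
  obtain d1 where d1: "d1 > 0" "\<And>D. D tagged_division_of {a..b} \<Longrightarrow> (\<forall>(x, K)\<in>D. Sup K - Inf K < d1) \<Longrightarrow>
        \<bar>(\<Sum>(x, K)\<in>D. f x * (g (Sup K) - g (Inf K))) - I\<bar> < e"
    using I \<open>e > 0\<close> unfolding has_rs_integral_def by meson
  obtain d2 where d2: "d2 > 0" "\<And>D. D tagged_division_of {a..b} \<Longrightarrow> (\<forall>(x, K)\<in>D. Sup K - Inf K < d2) \<Longrightarrow>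
        \<bar>(\<Sum>(x, K)\<in>D. f x * (g (Sup K) - g (Inf K))) - J\<bar> < e"
    using J \<open>e > 0\<close> unfolding has_rs_integral_def by meson
  \<comment> \<open>An interval inside a ball of radius \<open>d\<close> has length at most \<open>2 * d\<close>, which is below both meshes.\<close>
  define d where "d = min d1 d2 / 3"
  have "d > 0" using d1 d2 by (simp add: d_def)
  obtain D where D: "D tagged_division_of {a..b}" "(\<lambda>x. ball x d) fine D"
    using fine_division_exists_real[OF gauge_ball[OF \<open>d > 0\<close>]] by metis
  have small: "Sup K - Inf K < min d1 d2" if xK: "(x, K) \<in> D" for x K
  proof -
    obtain l m where K: "K = {l..m}"
      using tagged_division_ofD(4)[OF D(1) xK] by auto
    have "x \<in> K" by (rule tagged_division_ofD(2)[OF D(1) that])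
    then have "l \<le> m" using K by auto
    have "K \<subseteq> ball x d" using D(2) that by (auto simp: fine_def)
    then have "l \<in> ball x d" "m \<in> ball x d" using K \<open>l \<le> m\<close> by auto
    then have "m - l < 2 * d" by (auto simp: dist_real_def)
    then show ?thesis using K \<open>l \<le> m\<close> d1(1) d2(1) by (auto simp: d_def min_def split: if_splits)
  qed
  define X where "X = (\<Sum>(x, K)\<in>D. f x * (g (Sup K) - g (Inf K)))"
  have "\<bar>X - I\<bar> < e"
    unfolding X_def by (rule d1(2)[OF D(1)]) (use small in auto)
  moreover have "\<bar>X - J\<bar> < e"
    unfolding X_def by (rule d2(2)[OF D(1)]) (use small in auto)
  moreover have "2 * e = \<bar>I - J\<bar>" by (simp add: e_def)
  ultimately show False by linarith
qed

text \<open>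
  On each interval \<open>K\<close> of a division, with tag \<open>x\<close>, the increment of \<open>g\<close> is the integral of \<open>g'\<close>, so the sum
  and the integral differ by the sum of the integrals of \<open>(f x - f s) * g' s\<close>; uniform
  continuity of \<open>f\<close> and the bound on \<open>g'\<close> make this small with the mesh.
\<close>
lemma has_rs_integral_pw_primitive:
  assumes f: "continuous_on {0..1} f" and g: "pw_primitive g g'" and t: "0 \<le> t" "t \<le> 1"
  shows "has_rs_integral f g 0 t (integral {0..t} (\<lambda>s. f s * g' s))"
  unfolding has_rs_integral_def
proof (intro allI impI)
  fix \<epsilon> :: real assume "\<epsilon> > 0"
  have ft: "continuous_on {0..t} f" using t by (intro continuous_on_subset[OF f]) auto
  obtain B where B: "\<And>s. \<bar>g' s\<bar> \<le> B" using g unfolding pw_primitive_def by blast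
  have "B \<ge> 0" using B[of 0] by linarith
  define e where "e = \<epsilon> / (2 * (B + 1))"
  have "e > 0" using \<open>\<epsilon> > 0\<close> \<open>B \<ge> 0\<close> by (simp add: e_def)
  have "uniformly_continuous_on {0..t} f" by (rule compact_uniformly_continuous[OF ft]) simp
  then obtain \<delta> where "\<delta> > 0" and \<delta>: "\<And>x y. x \<in> {0..t} \<Longrightarrow> y \<in> {0..t} \<Longrightarrow> dist y x < \<delta> \<Longrightarrow> dist (f y) (f x) < e"
    using \<open>e > 0\<close> unfolding uniformly_continuous_on_def by meson
  show "\<exists>\<delta>>0. \<forall>D. D tagged_division_of {0..t} \<and> (\<forall>(x, K)\<in>D. Sup K - Inf K < \<delta>) \<longrightarrow>
        \<bar>(\<Sum>(x, K)\<in>D. f x * (g (Sup K) - g (Inf K))) - integral {0..t} (\<lambda>s. f s * g' s)\<bar> < \<epsilon>"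
  proof (intro exI[of _ \<delta>] conjI \<open>\<delta> > 0\<close> allI impI, elim conjE)
    fix D assume D: "D tagged_division_of {0..t}" and mesh: "\<forall>(x, K)\<in>D. Sup K - Inf K < \<delta>"
    have "(\<lambda>s. f s * g' s) integrable_on {0..t}" by (rule pw_primitive_times_integrable_on[OF ft g])
    then have "integral {0..t} (\<lambda>s. f s * g' s) = (\<Sum>(x, K)\<in>D. integral K (\<lambda>s. f s * g' s))"
      using integral_combine_tagged_division_topdown[of "\<lambda>s. f s * g' s" 0 t D] D by simp
    then have "(\<Sum>(x, K)\<in>D. f x * (g (Sup K) - g (Inf K))) - integral {0..t} (\<lambda>s. f s * g' s)
       = (\<Sum>(x, K)\<in>D. f x * (g (Sup K) - g (Inf K)) - integral K (\<lambda>s. f s * g' s))"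
      by (simp add: sum_subtractf case_prod_unfold)
    also have "\<bar>\<dots>\<bar> \<le> (\<Sum>(x, K)\<in>D. e * B * measure lborel K)"
    proof (rule order_trans[OF sum_abs], rule sum_mono, clarify)
      fix x K assume xK: "(x, K) \<in> D"
      obtain l m where K: "K = {l..m}"
        using tagged_division_ofD(4)[OF D xK] by auto
      have x: "x \<in> K" by (rule tagged_division_ofD(2)[OF D xK])
      have sub: "K \<subseteq> {0..t}" by (rule tagged_division_ofD(3)[OF D xK])
      have lm: "l \<le> m" "0 \<le> l" "m \<le> t" using K x sub by auto
      have "m - l < \<delta>" using mesh xK K lm by auto
      have g_int: "(g' has_integral g m - g l) {l..m}"
        using lm t by (intro pw_primitive_FTC[OF g]) auto
      have fg_int: "(\<lambda>s. f s * g' s) integrable_on {l..m}"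
        using lm by (intro pw_primitive_times_integrable_on[OF _ g] continuous_on_subset[OF ft]) auto
      have "((\<lambda>s. f x * g' s - f s * g' s) has_integral
              f x * (g m - g l) - integral {l..m} (\<lambda>s. f s * g' s)) {l..m}"
        by (intro has_integral_diff has_integral_mult_right g_int integrable_integral fg_int)
      moreover have "norm (f x * g' s - f s * g' s) \<le> e * B" if "s \<in> {l..m}" for s
      proof -
        have "dist (f x) (f s) < e"
          using that x K sub \<open>m - l < \<delta>\<close> by (intro \<delta>) (auto simp: dist_real_def)
        then have "\<bar>f x - f s\<bar> * \<bar>g' s\<bar> \<le> e * B"
          using B[of s] by (intro mult_mono) (auto simp: dist_real_def)
        then show ?thesis by (simp add: abs_mult left_diff_distrib[symmetric])
      qed
      ultimately have "norm (f x * (g m - g l) - integral {l..m} (\<lambda>s. f s * g' s)) \<le> e * B * measure lborel {l..m}"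
        using \<open>e > 0\<close> \<open>B \<ge> 0\<close> by (intro has_integral_bound_real[of "e * B" "{}"]) auto
      then show "\<bar>f x * (g (Sup K) - g (Inf K)) - integral K (\<lambda>s. f s * g' s)\<bar> \<le> e * B * measure lborel K"
        using K lm by simp
    qed
    also have "\<dots> = e * B * measure lborel {0..t}"
      using additive_content_tagged_division[of D 0 t] D
      by (simp add: sum_distrib_left[symmetric] case_prod_unfold)
    also have "\<dots> \<le> e * B * 1" using t \<open>e > 0\<close> \<open>B \<ge> 0\<close> by (intro mult_left_mono) auto
    also have "\<dots> < \<epsilon>"
    proof -
      have "e * B \<le> e * (B + 1)" using \<open>e > 0\<close> by simp
      also have "\<dots> = \<epsilon> / 2" using \<open>B \<ge> 0\<close> by (simp add: e_def field_simps)
      finally show ?thesis using \<open>\<epsilon> > 0\<close> by simp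
    qed
    finally show "\<bar>(\<Sum>(x, K)\<in>D. f x * (g (Sup K) - g (Inf K))) - integral {0..t} (\<lambda>s. f s * g' s)\<bar> < \<epsilon>" .
  qed
qed

lemma rs_integral_pw_primitive:
  assumes "continuous_on {0..1} f" "pw_primitive g g'" "0 \<le> t" "t \<le> 1"
  shows "rs_integral f g 0 t = integral {0..t} (\<lambda>s. f s * g' s)"
  unfolding rs_integral_def
  by (rule the_equality) (use has_rs_integral_pw_primitive[OF assms] has_rs_integral_unique in blast)+

section \<open>Haar and Schauder functions\<close>

text \<open>
  The primitive of \<open>haar_mother\<close> that vanishes at 0; Schauder functions of level \<open>n \<ge> 0\<close> are its rescalings.
\<close>
definition tent :: "real \<Rightarrow> real" where
  "tent x = max 0 (min x (1 - x))"

lemma tent_continuous [continuous_intros]: "continuous_on A u \<Longrightarrow> continuous_on A (\<lambda>x. tent (u x))"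
  unfolding tent_def by (intro continuous_intros)

lemma tent_has_derivative:
  assumes "x \<notin> {0, 1/2, 1}"
  shows "(tent has_real_derivative haar_mother x) (at x)"
proof -
  consider "x < 0" | "0 < x" "x < 1/2" | "1/2 < x" "x < 1" | "x > 1"
    using assms by fastforce
  then show ?thesis
  proof cases
    case 1
    have "((\<lambda>_. 0) has_real_derivative haar_mother x) (at x)"
      using 1 by (simp add: haar_mother_def)
    then show ?thesis
      by (rule has_field_derivative_transform_within_open[where S = "{..<0}"]) (use 1 in \<open>auto simp: tent_def\<close>)
  next
    case 2
    have "((\<lambda>y. y) has_real_derivative haar_mother x) (at x)"
      using 2 by (simp add: haar_mother_def)
    then show ?thesis
      by (rule has_field_derivative_transform_within_open[where S = "{0<..<1/2}"]) (use 2 in \<open>auto simp: tent_def\<close>)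
  next
    case 3
    have "((\<lambda>y. 1 - y) has_real_derivative haar_mother x) (at x)"
      using 3 by (auto simp: haar_mother_def intro!: derivative_eq_intros)
    then show ?thesis
      by (rule has_field_derivative_transform_within_open[where S = "{1/2<..<1}"]) (use 3 in \<open>auto simp: tent_def\<close>)
  next
    case 4
    have "((\<lambda>_. 0) has_real_derivative haar_mother x) (at x)"
      using 4 by (simp add: haar_mother_def)
    then show ?thesis
      by (rule has_field_derivative_transform_within_open[where S = "{1<..}"]) (use 4 in \<open>auto simp: tent_def\<close>)
  qed
qed

lemma haar_nat: "haar (int m) k s = 2 powr (real m / 2) * haar_mother (2 ^ m * s - real k)"
  by (simp add: haar_def)

lemma haar_root: "s \<in> {0..1} \<Longrightarrow> haar (-1) k s = 1"
  by (simp add: haar_def)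

lemma scaled_tent_has_derivative:
  assumes "s \<notin> (\<lambda>z. (z + real k) / 2 ^ m) ` {0, 1/2, 1}"
  shows "((\<lambda>s. 2 powr (real m / 2) / 2 ^ m * tent (2 ^ m * s - real k))
           has_real_derivative haar (int m) k s) (at s)"
proof -
  have "2 ^ m * s - real k \<notin> {0, 1/2, 1}"
  proof
    assume "2 ^ m * s - real k \<in> {0, 1/2, 1}"
    moreover have "s = ((2 ^ m * s - real k) + real k) / 2 ^ m" by simp
    ultimately show False using assms by blast
  qed
  moreover have "((\<lambda>s. 2 ^ m * s - real k) has_real_derivative 2 ^ m) (at s)"
    by (auto intro!: derivative_eq_intros)
  ultimately have "((\<lambda>s. tent (2 ^ m * s - real k)) has_real_derivative 2 ^ m * haar_mother (2 ^ m * s - real k)) (at s)"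
    using DERIV_chain2[OF tent_has_derivative, of "\<lambda>s. 2 ^ m * s - real k" s "2 ^ m" UNIV]
    by (simp add: mult.commute)
  from DERIV_cmult[OF this, of "2 powr (real m / 2) / 2 ^ m"] show ?thesis
    by (simp add: haar_nat)
qed

lemma schauder_nat:
  assumes "s \<ge> 0"
  shows "schauder (int m) k s = 2 powr (real m / 2) / 2 ^ m * tent (2 ^ m * s - real k)"
proof -
  let ?e = "\<lambda>s. 2 powr (real m / 2) / 2 ^ m * tent (2 ^ m * s - real k)"
  have "(haar (int m) k has_integral ?e s - ?e 0) {0..s}"
  proof (rule fundamental_theorem_of_calculus_interior_strong[OF _ assms])
    show "finite ((\<lambda>z. (z + real k) / 2 ^ m) ` {0, 1/2, 1})" by simp
    show "(?e has_vector_derivative haar (int m) k x) (at x)"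
      if "x \<in> {0<..<s} - (\<lambda>z. (z + real k) / 2 ^ m) ` {0, 1/2, 1}" for x
      using scaled_tent_has_derivative[of x k m] that
      by (simp add: has_real_derivative_iff_has_vector_derivative)
  qed (intro continuous_intros)
  then show ?thesis by (simp add: schauder_def integral_unique tent_def)
qed

lemma schauder_root:
  assumes "s \<in> {0..1}"
  shows "schauder (-1) k s = s"
proof -
  have "integral {0..s} (haar (-1) k) = integral {0..s} (\<lambda>_. 1)"
    using assms by (intro integral_cong) (auto intro: haar_root)
  then show ?thesis using assms by (simp add: schauder_def)
qed

lemma haar_mother_measurable [measurable]: "haar_mother \<in> borel_measurable borel"
  unfolding haar_mother_def[abs_def] by measurable

lemma pw_primitive_schauder_root: "pw_primitive (schauder (-1) k) (haar (-1) k)"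
proof -
  have "continuous_on {0..1} (schauder (-1) k) \<longleftrightarrow> continuous_on {0..1} (\<lambda>s::real. s)"
    by (rule continuous_on_cong) (auto simp: schauder_root)
  moreover have "(schauder (-1) k has_real_derivative haar (-1) k x) (at x)" if "x \<in> {0<..<1}" for x
  proof (rule has_field_derivative_transform_within_open[where S = "{0<..<1}" and f = "\<lambda>s. s"])
    show "((\<lambda>s. s) has_real_derivative haar (-1) k x) (at x)" using that by (simp add: haar_root)
  qed (use that in \<open>auto simp: schauder_root\<close>)
  moreover have "haar (-1) k \<in> borel_measurable borel"
    by (simp add: haar_def[abs_def])
  moreover have "\<bar>haar (-1) k s\<bar> \<le> 1" for s
    by (simp add: haar_def indicator_def)
  ultimately show ?thesis unfolding pw_primitive_def by (blast intro: continuous_on_id)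
qed

lemma pw_primitive_schauder_nat: "pw_primitive (schauder (int m) k) (haar (int m) k)"
proof -
  let ?e = "\<lambda>s. 2 powr (real m / 2) / 2 ^ m * tent (2 ^ m * s - real k)"
  let ?S = "(\<lambda>z. (z + real k) / 2 ^ m) ` {0, 1/2, 1}"
  have "continuous_on {0..1} (schauder (int m) k) \<longleftrightarrow> continuous_on {0..1} ?e"
    by (rule continuous_on_cong) (auto simp: schauder_nat)
  moreover have "continuous_on {0..1} ?e" by (intro continuous_intros)
  moreover have "(schauder (int m) k has_real_derivative haar (int m) k x) (at x)"
    if "x \<in> {0<..<1} - ?S" for x
    by (rule has_field_derivative_transform_within_open[where S = "{0<..<1}" and f = ?e])
       (use that scaled_tent_has_derivative in \<open>auto simp: schauder_nat\<close>)
  moreover have "finite ?S" by simp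
  moreover have "haar (int m) k \<in> borel_measurable borel"
    unfolding haar_nat[abs_def] by measurable
  moreover have "\<bar>haar (int m) k s\<bar> \<le> 2 powr (real m / 2)" for s
    by (simp add: haar_nat haar_mother_def)
  ultimately show ?thesis unfolding pw_primitive_def by blast
qed

text \<open>
  Blocks are numbered by \<open>j = n + 1\<close>, so that sums over levels \<open>n \<ge> -1\<close> become sums over naturals.
\<close>
lemma level_cases:
  obtains "int j - 1 = -1" "j = 0" | m where "int j - 1 = int m" "j = Suc m"
  by (cases j) auto

lemma pw_primitive_schauder: "pw_primitive (schauder (int j - 1) k) (haar (int j - 1) k)"
  by (cases j rule: level_cases) (simp_all only: pw_primitive_schauder_root pw_primitive_schauder_nat)

lemma finite_level_idx [simp]: "finite (level_idx n)"
  by (simp add: level_idx_def)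

lemma level_idx_nat: "level_idx (int m) = {..<2 ^ m}"
  by (simp add: level_idx_def)

lemma level_idx_root: "level_idx (-1) = {0}"
  by (simp add: level_idx_def)

text \<open>
  A Schauder function is dominated pointwise by the modulus of its own derivative, with a factor
  comparable to the length of its support: \<open>tent\<close> is at most 1/2 and vanishes where \<open>haar_mother\<close> does.
  Through this bound the integral of one block against another is estimated by Haar functions alone.
\<close>
lemma abs_schauder_le_haar:
  assumes "s \<in> {0..1}"
  shows "\<bar>schauder (int j - 1) k s\<bar> \<le> \<bar>haar (int j - 1) k s\<bar> / 2 ^ j"
proof (cases j rule: level_cases)
  case 1
  then show ?thesis using assms by (simp only: 1 schauder_root haar_root) auto
next
  case (2 m)
  have "\<bar>tent x\<bar> \<le> \<bar>haar_mother x\<bar> / 2" for x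
    by (auto simp: tent_def haar_mother_def)
  from mult_left_mono[OF this, of "2 powr (real m / 2) / 2 ^ m" "2 ^ m * s - real k"]
  show ?thesis using assms unfolding 2 by (simp add: schauder_nat haar_nat abs_mult)
qed

lemma abs_schauder_le:
  assumes "s \<in> {0..1}"
  shows "\<bar>schauder (int m) k s\<bar> \<le> 2 powr - (real m / 2)"
proof -
  have "\<bar>tent x\<bar> \<le> 1" for x by (auto simp: tent_def)
  from mult_left_mono[OF this, of "2 powr (real m / 2) / 2 ^ m" "2 ^ m * s - real k"]
  have "\<bar>schauder (int m) k s\<bar> \<le> 2 powr (real m / 2) / 2 ^ m"
    using assms by (simp add: schauder_nat abs_mult)
  also have "\<dots> = 2 powr (real m / 2) / 2 powr real m" by (simp add: powr_realpow)
  also have "\<dots> = 2 powr - (real m / 2)" by (simp add: powr_diff[symmetric])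
  finally show ?thesis .
qed

text \<open>
  The half-open cells carrying the functions of one level are disjoint.  The right end point 1, where all Haar functions of level
  \<open>n \<ge> 0\<close> vanish, needs no active index, and any index serves.
\<close>
lemma one_active_index:
  assumes s: "s \<in> {0..1}"
  obtains k where "k \<in> level_idx (int j - 1)"
    "\<And>k'. k' \<in> level_idx (int j - 1) \<Longrightarrow> k' \<noteq> k \<Longrightarrow>
       haar (int j - 1) k' s = 0 \<and> schauder (int j - 1) k' s = 0"
proof (cases j rule: level_cases)
  case 1
  then show ?thesis using that[of 0] by (simp only: 1 level_idx_root) blast
next
  case (2 m)
  define k where "k = (if s < 1 then nat \<lfloor>2 ^ m * s\<rfloor> else 0)"
  have "k < 2 ^ m"
  proof (cases "s < 1")
    case True
    have "real_of_int \<lfloor>2 ^ m * s\<rfloor> \<le> 2 ^ m * s" by simp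
    also have "\<dots> < 2 ^ m" using True by simp
    finally have "\<lfloor>2 ^ m * s\<rfloor> < 2 ^ m" by (metis of_int_less_numeral_power_cancel_iff)
    then show ?thesis using True by (simp add: k_def nat_less_iff)
  qed (simp add: k_def)
  have zero: "haar_mother (2 ^ m * s - real k') = 0 \<and> tent (2 ^ m * s - real k') = 0"
    if "k' < 2 ^ m" "k' \<noteq> k" for k'
  proof -
    have "2 ^ m * s - real k' \<ge> 1 \<or> 2 ^ m * s - real k' < 0"
    proof (cases "s < 1")
      case True
      have k: "real k \<le> 2 ^ m * s" "2 ^ m * s < real k + 1"
        using True s by (auto simp: k_def)
      have "k' + 1 \<le> k \<or> k + 1 \<le> k'" using that by linarith
      then have "real k' + 1 \<le> real k \<or> real k + 1 \<le> real k'" by linarith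
      then show ?thesis using k by linarith
    next
      case False
      then have "s = 1" using s by simp
      have "k' + 1 \<le> 2 ^ m" using that by simp
      then have "real (k' + 1) \<le> real (2 ^ m)" by (rule of_nat_mono)
      then show ?thesis using \<open>s = 1\<close> by simp
    qed
    then show ?thesis by (auto simp: haar_mother_def tent_def)
  qed
  show ?thesis
    by (rule that[of k]) (use \<open>k < 2 ^ m\<close> zero s in \<open>auto simp: 2 level_idx_nat haar_nat schauder_nat\<close>)
qed

section \<open>Blocks of one level\<close>

definition schauder_block :: "(real \<Rightarrow> real) \<Rightarrow> nat \<Rightarrow> real \<Rightarrow> real" where
  "schauder_block f j s = (\<Sum>k\<in>level_idx (int j - 1). fs_coeff f (int j - 1) k * schauder (int j - 1) k s)"

definition haar_block :: "(real \<Rightarrow> real) \<Rightarrow> nat \<Rightarrow> real \<Rightarrow> real" where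
  "haar_block f j s = (\<Sum>k\<in>level_idx (int j - 1). fs_coeff f (int j - 1) k * haar (int j - 1) k s)"

lemma pw_primitive_block: "pw_primitive (schauder_block f j) (haar_block f j)"
  unfolding schauder_block_def[abs_def] haar_block_def[abs_def]
  by (intro pw_primitive_sum finite_level_idx pw_primitive_cmult pw_primitive_schauder)

lemma schauder_block_0 [simp]: "schauder_block f j 0 = 0"
  by (simp add: schauder_block_def schauder_def)

text \<open>
  Since at most one term of a block is nonzero at a point, powers and absolute values pass through
  the sum over \<open>k\<close>.
\<close>
lemma blocks_at_active_index:
  assumes "s \<in> {0..1}"
  shows "\<exists>k\<in>level_idx (int j - 1). schauder_block f j s = fs_coeff f (int j - 1) k * schauder (int j - 1) k s \<and>
    haar_block f j s = fs_coeff f (int j - 1) k * haar (int j - 1) k s \<and>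
    (\<forall>p. (\<Sum>k\<in>level_idx (int j - 1). \<bar>fs_coeff f (int j - 1) k * haar (int j - 1) k s\<bar> powr p)
       = \<bar>haar_block f j s\<bar> powr p)"
proof -
  obtain k where k: "k \<in> level_idx (int j - 1)"
    "\<And>k'. k' \<in> level_idx (int j - 1) \<Longrightarrow> k' \<noteq> k \<Longrightarrow>
       haar (int j - 1) k' s = 0 \<and> schauder (int j - 1) k' s = 0"
    using one_active_index[OF assms, of j] by blast
  have single: "(\<Sum>k'\<in>level_idx (int j - 1). w k') = w k"
    if "\<And>k'. k' \<in> level_idx (int j - 1) \<Longrightarrow> k' \<noteq> k \<Longrightarrow> w k' = 0" for w :: "nat \<Rightarrow> real"
    using sum.mono_neutral_right[of "level_idx (int j - 1)" "{k}" w] k(1) that by auto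
  have 1: "schauder_block f j s = fs_coeff f (int j - 1) k * schauder (int j - 1) k s"
    unfolding schauder_block_def by (rule single) (simp add: k(2))
  have 2: "haar_block f j s = fs_coeff f (int j - 1) k * haar (int j - 1) k s"
    unfolding haar_block_def by (rule single) (simp add: k(2))
  have "(\<Sum>k\<in>level_idx (int j - 1). \<bar>fs_coeff f (int j - 1) k * haar (int j - 1) k s\<bar> powr p)
       = \<bar>haar_block f j s\<bar> powr p" for p
    unfolding 2 by (rule single) (simp add: k(2))
  with k(1) 1 2 show ?thesis by blast
qed

lemma abs_schauder_block_le_haar_block:
  assumes "s \<in> {0..1}"
  shows "\<bar>schauder_block f j s\<bar> \<le> \<bar>haar_block f j s\<bar> / 2 ^ j"
proof -
  obtain k where k: "schauder_block f j s = fs_coeff f (int j - 1) k * schauder (int j - 1) k s"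
    "haar_block f j s = fs_coeff f (int j - 1) k * haar (int j - 1) k s"
    using blocks_at_active_index[OF assms] by blast
  show ?thesis
    using mult_left_mono[OF abs_schauder_le_haar[OF assms, of j k], of "\<bar>fs_coeff f (int j - 1) k\<bar>"]
    by (simp add: k abs_mult)
qed

text \<open>
  The second factor corrects the exponent at level -1, where the Haar function is the constant 1
  on the whole interval instead of following the scaling of the other levels.
\<close>
lemma haar_powr_has_integral:
  assumes k: "k \<in> level_idx (int j - 1)"
  shows "((\<lambda>s. \<bar>haar (int j - 1) k s\<bar> powr p) has_integral 2 powr ((real j - 1) * (p / 2 - 1)) * (if j = 0 then 2 powr (p / 2 - 1) else 1)) {0..1}"
proof (cases j rule: level_cases)
  case 1
  have "((\<lambda>s::real. 1::real) has_integral 1) {0..1}"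
    using has_integral_const_real[of "1::real" 0 1] by simp
  then have "((\<lambda>s. \<bar>haar (-1) k s\<bar> powr p) has_integral 1) {0..1}"
    by (rule has_integral_eq[rotated]) (simp add: haar_root)
  then show ?thesis using 1 by (simp add: powr_add[symmetric])
next
  case (2 m)
  let ?I = "{real k / 2 ^ m..<(real k + 1) / 2 ^ m}"
  let ?c = "2 powr (real m * p / 2)"
  have "k < 2 ^ m" using k 2 by (simp add: level_idx_nat)
  then have "k + 1 \<le> 2 ^ m" by simp
  then have "real (k + 1) \<le> real (2 ^ m)" by (rule of_nat_mono)
  then have "(real k + 1) / 2 ^ m \<le> 1" by simp
  moreover have "0 \<le> real k / 2 ^ m" by simp
  ultimately have sub: "?I \<subseteq> {0..1}"
    unfolding subset_iff atLeastLessThan_iff atLeastAtMost_iff by linarith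
  have len: "real k / 2 ^ m \<le> (real k + 1) / 2 ^ m" by (simp add: divide_right_mono)
  have "((\<lambda>x. 1::real) has_integral measure lborel ?I) ?I"
    using len by (intro has_integral_measure_lborel) (auto)
  moreover have "measure lborel ?I = 1 / 2 ^ m"
    using len by (simp add: diff_divide_distrib[symmetric])
  ultimately have "((\<lambda>x. if x \<in> ?I then 1 else (0::real)) has_integral 1 / 2 ^ m) {0..1}"
    using has_integral_restrict[OF sub, of "\<lambda>_. 1::real"] by simp
  then have "((\<lambda>x. ?c * (if x \<in> ?I then 1 else 0)) has_integral ?c * (1 / 2 ^ m)) {0..1}"
    by (rule has_integral_mult_right)
  moreover have "?c * (if x \<in> ?I then 1 else 0) = \<bar>haar (int m) k x\<bar> powr p" for x
  proof (cases "x \<in> ?I")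
    case True
    then have "0 \<le> 2 ^ m * x - real k" "2 ^ m * x - real k < 1"
      by (auto simp: field_simps)
    then have "\<bar>haar_mother (2 ^ m * x - real k)\<bar> = 1" by (auto simp: haar_mother_def)
    then show ?thesis using True by (simp add: haar_nat abs_mult powr_powr)
  next
    case False
    then have "\<not> (0 \<le> 2 ^ m * x - real k \<and> 2 ^ m * x - real k < 1)"
      by (auto simp: field_simps)
    then have "haar_mother (2 ^ m * x - real k) = 0" by (auto simp: haar_mother_def)
    then show ?thesis using False by (simp add: haar_nat)
  qed
  moreover have "?c * (1 / 2 ^ m) = 2 powr (real m * (p / 2 - 1))"
    by (simp add: right_diff_distrib powr_diff powr_realpow)
  ultimately show ?thesis by (simp add: 2)
qed

text \<open>
  The level energy is a rescaled $L^p$ norm of the Haar block.  The normalization chosen for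
  level -1 makes this one formula valid for all \<open>j\<close>.
\<close>
lemma haar_block_powr_has_integral:
  assumes "p > 0"
  shows "((\<lambda>s. \<bar>haar_block f j s\<bar> powr p) has_integral
           2 powr ((real j - 1) * (p - 1)) * level_energy p f (int j - 1) powr p) {0..1}"
proof -
  let ?n = "int j - 1"
  let ?w = "2 powr ((real j - 1) * (p / 2 - 1)) * (if j = 0 then 2 powr (p / 2 - 1) else 1)"
  have "((\<lambda>s. \<Sum>k\<in>level_idx ?n. \<bar>fs_coeff f ?n k\<bar> powr p * \<bar>haar ?n k s\<bar> powr p) has_integral
      (\<Sum>k\<in>level_idx ?n. \<bar>fs_coeff f ?n k\<bar> powr p * ?w)) {0..1}"
    by (intro has_integral_sum finite_level_idx has_integral_mult_right haar_powr_has_integral)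
  then have "((\<lambda>s. \<bar>haar_block f j s\<bar> powr p) has_integral (\<Sum>k\<in>level_idx ?n. \<bar>fs_coeff f ?n k\<bar> powr p * ?w)) {0..1}"
  proof (rule has_integral_eq[rotated])
    fix s :: real assume "s \<in> {0..1}"
    then show "(\<Sum>k\<in>level_idx ?n. \<bar>fs_coeff f ?n k\<bar> powr p * \<bar>haar ?n k s\<bar> powr p) = \<bar>haar_block f j s\<bar> powr p"
      using blocks_at_active_index[of s j f] by (auto simp: abs_mult powr_mult)
  qed
  moreover have "(\<Sum>k\<in>level_idx ?n. \<bar>fs_coeff f ?n k\<bar> powr p * ?w)
      = 2 powr ((real j - 1) * (p - 1)) * level_energy p f ?n powr p"
  proof (cases j rule: level_cases)
    case 1
    have "(1 - 1 / p) * p = p - 1" using assms by (simp add: left_diff_distrib)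
    then have "(2 powr (1 - 1 / p)) powr p = 2 powr (p - 1)" by (simp add: powr_powr)
    then have "level_energy p f (-1) powr p = 2 powr (p - 1) * \<bar>fs_coeff f (-1) 0\<bar> powr p"
      by (simp add: level_energy_def powr_mult)
    moreover have "2 powr (1 - p) * (2 powr (p - 1)) = (1::real)" "2 powr (1 - p / 2) * 2 powr (p / 2 - 1) = (1::real)"
      by (simp_all add: powr_add[symmetric])
    ultimately show ?thesis using 1 by (simp add: level_idx_root)
  next
    case (2 m)
    let ?T = "\<Sum>k\<in>level_idx (int m). \<bar>fs_coeff f (int m) k\<bar> powr p"
    have "?T \<ge> 0" by (simp add: sum_nonneg)
    then have "level_energy p f (int m) powr p = 2 powr (- (real m * p / 2)) * ?T"
      using assms by (simp add: level_energy_def powr_powr)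
    moreover have "2 powr (real m * (p - 1)) * 2 powr (- (real m * p / 2)) = 2 powr (real m * (p / 2 - 1))"
      by (simp add: powr_add[symmetric] field_simps)
    ultimately have "2 powr (real m * (p - 1)) * level_energy p f (int m) powr p = 2 powr (real m * (p / 2 - 1)) * ?T"
      by (simp only: mult.assoc[symmetric])
    then show ?thesis by (simp add: 2 sum_distrib_right mult.commute)
  qed
  ultimately show ?thesis by simp
qed

section \<open>Truncations as dyadic interpolation\<close>

text \<open>
  Whether \<open>2 ^ i * s\<close> reaches a given natural number only depends on the dyadic cell of \<open>s\<close> at a level \<open>n \<ge> i\<close>; the
  Haar functions of level below \<open>n\<close> are defined by such comparisons, hence constant on the cell.
\<close>
lemma dyadic_threshold:
  assumes "i \<le> n" "real k / 2 ^ n \<le> s" "s < (real k + 1) / 2 ^ n"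
  shows "real w \<le> 2 ^ i * s \<longleftrightarrow> w * 2 ^ (n - i) \<le> k"
proof -
  have n: "(2::real) ^ n = 2 ^ i * 2 ^ (n - i)" using assms(1) by (simp flip: power_add)
  have s: "real k \<le> 2 ^ n * s" "2 ^ n * s < real k + 1" using assms by (auto simp: field_simps)
  have "real w \<le> 2 ^ i * s \<longleftrightarrow> real w * 2 ^ (n - i) \<le> 2 ^ i * s * 2 ^ (n - i)"
    by (simp)
  also have "\<dots> \<longleftrightarrow> real (w * 2 ^ (n - i)) \<le> 2 ^ n * s" by (simp add: n mult_ac)
  also have "\<dots> \<longleftrightarrow> w * 2 ^ (n - i) \<le> k"
  proof
    assume "real (w * 2 ^ (n - i)) \<le> 2 ^ n * s"
    then have "real (w * 2 ^ (n - i)) < real k + 1" using s by linarith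
    then show "w * 2 ^ (n - i) \<le> k" by linarith
  next
    assume "w * 2 ^ (n - i) \<le> k"
    then have "real (w * 2 ^ (n - i)) \<le> real k" by (rule of_nat_mono)
    then show "real (w * 2 ^ (n - i)) \<le> 2 ^ n * s" using s by linarith
  qed
  finally show ?thesis .
qed

lemma haar_block_constant_on_cell:
  assumes j: "j \<le> n" and k: "k < 2 ^ n" and s: "s \<in> {dyadic_pt n k..<dyadic_pt n (Suc k)}"
  shows "haar_block f j s = haar_block f j (dyadic_pt n k)"
proof -
  let ?t = "dyadic_pt n k"
  have "real (Suc k) \<le> real (2 ^ n)" using k by (intro of_nat_mono) simp
  then have "dyadic_pt n (Suc k) \<le> 1" by (simp add: dyadic_pt_def)
  have "haar (int j - 1) k' s = haar (int j - 1) k' ?t" for k'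
  proof (cases j rule: level_cases)
    case 1
    have "0 \<le> ?t" by (simp add: dyadic_pt_def)
    then have "s \<in> {0..1}" "?t \<in> {0..1}"
      using s \<open>dyadic_pt n (Suc k) \<le> 1\<close> by auto
    then show ?thesis by (simp only: 1(1) haar_root)
  next
    case (2 m)
    have th: "real w \<le> 2 ^ Suc m * s \<longleftrightarrow> real w \<le> 2 ^ Suc m * ?t" for w
      using dyadic_threshold[of "Suc m" n k s w] dyadic_threshold[of "Suc m" n k ?t w] j s 2
      by (auto simp: dyadic_pt_def divide_right_mono divide_strict_right_mono add.commute)
    \<comment> \<open>Both breakpoints of the Haar function are multiples of \<open>1 / 2 ^ Suc m\<close>, and \<open>Suc m \<le> n\<close>.\<close>
    have hm: "haar_mother (2 ^ m * x - real k') =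
        (if real (2 * k') \<le> 2 ^ Suc m * x \<and> \<not> real (2 * k' + 1) \<le> 2 ^ Suc m * x then 1
         else if real (2 * k' + 1) \<le> 2 ^ Suc m * x \<and> \<not> real (2 * k' + 2) \<le> 2 ^ Suc m * x then -1 else 0)" for x
      by (auto simp: haar_mother_def)
    show ?thesis unfolding 2(1) haar_nat hm th ..
  qed
  then show ?thesis by (simp add: haar_block_def)
qed

lemma fs_trunc_eq: "fs_trunc N f t = f 0 + (\<Sum>j\<le>N. schauder_block f j t)"
proof -
  have "{-1..int N - 1} = (\<lambda>j. int j - 1) ` {..N}"
  proof -
    have "n \<in> (\<lambda>j. int j - 1) ` {..N}" if "n \<in> {-1..int N - 1}" for n
      using that by (intro image_eqI[of _ _ "nat (n + 1)"]) auto
    then show ?thesis by auto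
  qed
  moreover have "inj_on (\<lambda>j. int j - 1) {..N}" by (auto simp: inj_on_def)
  ultimately show ?thesis
    by (simp add: fs_trunc_def schauder_block_def sum.reindex)
qed

abbreviation haar_sum :: "nat \<Rightarrow> (real \<Rightarrow> real) \<Rightarrow> real \<Rightarrow> real" where
  "haar_sum N f s \<equiv> \<Sum>j\<le>N. haar_block f j s"

lemma pw_primitive_fs_trunc: "pw_primitive (fs_trunc N f) (haar_sum N f)"
proof -
  have "pw_primitive (\<lambda>s. f 0 + (\<Sum>j\<le>N. schauder_block f j s)) (\<lambda>s. 0 + haar_sum N f s)"
    by (intro pw_primitive_add pw_primitive_const pw_primitive_sum pw_primitive_block) simp
  then show ?thesis by (simp add: fs_trunc_eq[abs_def])
qed

lemma dyadic_pt_bounds: "k < 2 ^ n \<Longrightarrow> 0 \<le> dyadic_pt n k \<and> dyadic_pt n (Suc k) \<le> 1 \<and> dyadic_pt n k < dyadic_pt n (Suc k)"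
proof -
  assume "k < 2 ^ n"
  then have "real (Suc k) \<le> real (2 ^ n)" by (intro of_nat_mono) simp
  then show ?thesis by (simp add: dyadic_pt_def divide_strict_right_mono)
qed

lemma fs_trunc_affine_on_cell:
  assumes k: "k < 2 ^ n" and s: "s \<in> {dyadic_pt n k..dyadic_pt n (Suc k)}"
  shows "fs_trunc n f s = fs_trunc n f (dyadic_pt n k) + (s - dyadic_pt n k) * haar_sum n f (dyadic_pt n k)"
proof -
  let ?t = "dyadic_pt n k"
  note b = dyadic_pt_bounds[OF k]
  have "(haar_sum n f has_integral fs_trunc n f s - fs_trunc n f ?t) {?t..s}"
    using b s by (intro pw_primitive_FTC pw_primitive_fs_trunc) auto
  moreover have "(haar_sum n f has_integral (s - ?t) * haar_sum n f ?t) {?t..s}"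
  proof (rule has_integral_spike_finite[where S = "{dyadic_pt n (Suc k)}" and f = "\<lambda>_. haar_sum n f ?t"])
    show "((\<lambda>_. haar_sum n f ?t) has_integral (s - ?t) * haar_sum n f ?t) {?t..s}"
      using has_integral_const_real[of "haar_sum n f ?t" ?t s] s by simp
    show "haar_sum n f x = haar_sum n f ?t" if "x \<in> {?t..s} - {dyadic_pt n (Suc k)}" for x
      using that s by (intro sum.cong refl haar_block_constant_on_cell[OF _ k]) auto
  qed simp
  ultimately have "fs_trunc n f s - fs_trunc n f ?t = (s - ?t) * haar_sum n f ?t"
    by (rule has_integral_unique)
  then show ?thesis by simp
qed

lemma schauder_block_at_even:
  "schauder_block f (Suc n) (dyadic_pt n k) = 0"
proof -
  have "tent (real k - real k') = 0" for k'
  proof -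
    have "k + 1 \<le> k' \<or> k = k' \<or> k' + 1 \<le> k" by linarith
    then have "real k + 1 \<le> real k' \<or> real k = real k' \<or> real k' + 1 \<le> real k" by linarith
    then show ?thesis by (auto simp: tent_def)
  qed
  then show ?thesis by (simp add: schauder_block_def schauder_nat dyadic_pt_def)
qed

lemma schauder_block_at_odd:
  assumes "k < 2 ^ n"
  shows "schauder_block f (Suc n) (dyadic_pt (Suc n) (2 * k + 1))
    = f (dyadic_pt (Suc n) (2 * k + 1)) - (f (dyadic_pt n k) + f (dyadic_pt n (Suc k))) / 2"
proof -
  let ?m = "dyadic_pt (Suc n) (2 * k + 1)"
  have x: "2 ^ n * ?m - real k' = (real k - real k') + 1 / 2" for k'
    by (simp add: dyadic_pt_def field_simps)
  have "tent (2 ^ n * ?m - real k') = (if k' = k then 1 / 2 else 0)" for k'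
  proof -
    have "k + 1 \<le> k' \<or> k = k' \<or> k' + 1 \<le> k" by linarith
    then have "real k + 1 \<le> real k' \<or> k = k' \<or> real k' + 1 \<le> real k" by linarith
    then show ?thesis unfolding x by (auto simp: tent_def)
  qed
  moreover have "?m \<ge> 0" by (simp add: dyadic_pt_def)
  ultimately have "schauder_block f (Suc n) ?m
      = (\<Sum>k'<2 ^ n. if k' = k then fs_coeff f (int n) k * (2 powr (real n / 2) / 2 ^ n * (1 / 2)) else 0)"
    unfolding schauder_block_def by (intro sum.cong) (auto simp: schauder_nat level_idx_nat)
  also have "\<dots> = fs_coeff f (int n) k * (2 powr (real n / 2) / 2 ^ n * (1 / 2))"
    using assms by simp
  also have "\<dots> = (2 powr (real n / 2) * 2 powr (real n / 2)) / 2 ^ n * ((2 * f ?m - f (dyadic_pt n k) - f (dyadic_pt n (Suc k))) / 2)"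
    by (simp add: fs_coeff_def)
  also have "2 powr (real n / 2) * 2 powr (real n / 2) = (2::real) ^ n"
    by (simp add: powr_add[symmetric] powr_realpow)
  finally show ?thesis by (simp add: field_simps)
qed

text \<open>
  Going from \<open>n\<close> to \<open>n + 1\<close> keeps the old grid points, where the new block vanishes, and at a new
  midpoint the old affine piece takes the average of \<open>f\<close> at the two neighbours, to which the new block
  adds exactly the amount by which \<open>f\<close> differs from that average.
\<close>
lemma fs_trunc_interpolates:
  "k \<le> 2 ^ n \<Longrightarrow> fs_trunc n f (dyadic_pt n k) = f (dyadic_pt n k)"
proof (induction n arbitrary: k)
  case 0
  then have "k = 0 \<or> k = 1" by auto
  then show ?case
    by (auto simp: fs_trunc_eq schauder_block_def level_idx_root schauder_root dyadic_pt_def fs_coeff_def)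
next
  case (Suc n)
  have split: "fs_trunc (Suc n) f x = fs_trunc n f x + schauder_block f (Suc n) x" for x
    by (simp add: fs_trunc_eq)
  have twice: "dyadic_pt (Suc n) (2 * l) = dyadic_pt n l" for l
    by (simp add: dyadic_pt_def)
  show ?case
  proof (cases "even k")
    case True
    then obtain l where l: "k = 2 * l" by blast
    then show ?thesis
      using Suc.IH[of l] Suc.prems by (simp add: split twice schauder_block_at_even)
  next
    case False
    then obtain l where l: "k = 2 * l + 1" by (rule oddE)
    then have "l < 2 ^ n" using Suc.prems by simp
    let ?m = "dyadic_pt (Suc n) (2 * l + 1)" and ?a = "dyadic_pt n l" and ?b = "dyadic_pt n (Suc l)"
    have m: "?m = (?a + ?b) / 2" by (simp add: dyadic_pt_def field_simps)
    have ab: "?a \<le> ?b" using dyadic_pt_bounds[OF \<open>l < 2 ^ n\<close>] by simp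
    have "fs_trunc n f ?m = fs_trunc n f ?a + (?m - ?a) * haar_sum n f ?a"
      using ab m by (intro fs_trunc_affine_on_cell \<open>l < 2 ^ n\<close>) auto
    moreover have "fs_trunc n f ?b = fs_trunc n f ?a + (?b - ?a) * haar_sum n f ?a"
      using ab by (intro fs_trunc_affine_on_cell \<open>l < 2 ^ n\<close>) auto
    moreover have "?m - ?a = (?b - ?a) / 2" unfolding m by (simp add: field_simps)
    ultimately have "fs_trunc n f ?m = (fs_trunc n f ?a + fs_trunc n f ?b) / 2" by simp
    also have "\<dots> = (f ?a + f ?b) / 2"
      using \<open>l < 2 ^ n\<close> by (simp add: Suc.IH)
    finally have average: "fs_trunc n f ?m = (f ?a + f ?b) / 2" .
    show ?thesis
      unfolding l split average schauder_block_at_odd[OF \<open>l < 2 ^ n\<close>] by simp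
  qed
qed

section \<open>Summability in energy spaces\<close>

lemma finite_infsum_ennreal_imp_summable_on:
  assumes "\<And>x. x \<in> A \<Longrightarrow> z x \<ge> 0" "(\<Sum>\<^sub>\<infinity>x\<in>A. ennreal (z x)) < \<infinity>"
  shows "z summable_on A"
proof (rule nonneg_bdd_above_summable_on)
  show "bdd_above (sum z ` {F. F \<subseteq> A \<and> finite F})"
  proof (rule bdd_aboveI2)
    fix F assume F: "F \<in> {F. F \<subseteq> A \<and> finite F}"
    have "ennreal (sum z F) = (\<Sum>x\<in>F. ennreal (z x))"
      using F assms(1) by (intro sum_ennreal[symmetric]) auto
    also have "\<dots> = (\<Sum>\<^sub>\<infinity>x\<in>F. ennreal (z x))" using F by simp
    also have "\<dots> \<le> (\<Sum>\<^sub>\<infinity>x\<in>A. ennreal (z x))"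
      using F by (intro infsum_mono_neutral nonneg_summable_on_complete) auto
    also have "\<dots> = ennreal (enn2real (\<Sum>\<^sub>\<infinity>x\<in>A. ennreal (z x)))"
      using assms(2) by (simp add: less_top)
    finally show "sum z F \<le> enn2real (\<Sum>\<^sub>\<infinity>x\<in>A. ennreal (z x))"
      by (simp add: ennreal_le_iff enn2real_nonneg)
  qed
qed (rule assms(1))

lemma lp_norm_finite_imp:
  assumes "lp_norm p A a < \<infinity>"
  shows "(\<Sum>\<^sub>\<infinity>n\<in>A. epowr (a n) p) < \<infinity>"
proof (rule ccontr)
  assume "\<not> ?thesis"
  then have "(\<Sum>\<^sub>\<infinity>n\<in>A. epowr (a n) p) = \<infinity>" by (simp add: less_top[symmetric])
  then show False using assms by (simp add: lp_norm_def epowr_def)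
qed

lemma energy_space_finite_norms:
  assumes "f \<in> energy_space p"
  shows "lp_norm p {-1..} (\<lambda>n. ennreal (level_energy p f n)) < \<infinity>"
    "lp_norm p UNIV (schauder_tail f) < \<infinity>"
  using assms unfolding energy_space_def energy_norm_def by auto

lemma level_energy_nonneg: "level_energy p f n \<ge> 0"
  by (simp add: level_energy_def)

lemma summable_level_energies:
  assumes "f \<in> energy_space p"
  shows "summable (\<lambda>j. level_energy p f (int j - 1) powr p)"
proof -
  have "epowr (ennreal (level_energy p f n)) p = ennreal (level_energy p f n powr p)" for n
    by (simp add: epowr_def level_energy_nonneg)
  then have "(\<Sum>\<^sub>\<infinity>n\<in>{-1..}. ennreal (level_energy p f n powr p)) < \<infinity>"
    using lp_norm_finite_imp[OF energy_space_finite_norms(1)[OF assms]] by simp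
  then have "(\<lambda>n. level_energy p f n powr p) summable_on {-1..}"
    by (intro finite_infsum_ennreal_imp_summable_on) auto
  moreover have "{-1..} = range (\<lambda>j. int j - 1)"
  proof -
    have "n \<in> range (\<lambda>j. int j - 1)" if "n \<ge> -1" for n
      using that by (intro image_eqI[of _ _ "nat (n + 1)"]) auto
    then show ?thesis by auto
  qed
  moreover have "inj (\<lambda>j. int j - 1)" by (simp add: inj_on_def)
  ultimately have "((\<lambda>n. level_energy p f n powr p) \<circ> (\<lambda>j. int j - 1)) summable_on UNIV"
    using summable_on_reindex[of "\<lambda>j. int j - 1" UNIV "\<lambda>n. level_energy p f n powr p"] by simp
  then show ?thesis by (auto dest!: summable_on_imp_summable simp: o_def)
qed

lemma schauder_tail_0_finite:
  assumes "f \<in> energy_space p"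
  shows "schauder_tail f 0 < \<infinity>"
proof (rule ccontr)
  assume "\<not> ?thesis"
  then have "epowr (schauder_tail f 0) p = \<infinity>" by (simp add: less_top epowr_def)
  moreover have "(\<Sum>\<^sub>\<infinity>n\<in>{0::nat}. epowr (schauder_tail f n) p) \<le> (\<Sum>\<^sub>\<infinity>n. epowr (schauder_tail f n) p)"
    by (intro infsum_mono_neutral nonneg_summable_on_complete) auto
  ultimately show False
    using lp_norm_finite_imp[OF energy_space_finite_norms(2)[OF assms]] by (simp add: top_unique)
qed

text \<open>
  The sum over all levels of the bounds for single blocks is the first entry of the Schauder tail
  sequence, up to the level -1 term.
\<close>
lemma summable_block_bound:
  assumes "f \<in> energy_space p"
  obtains h where "summable h" "\<And>j s. s \<in> {0..1} \<Longrightarrow> \<bar>schauder_block f j s\<bar> \<le> h j"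
proof -
  define T where "T m = ennreal (2 powr - (real m / 2)) *
        (SUP k\<in>level_idx (int m). ennreal \<bar>fs_coeff f (int m) k\<bar>)" for m
  have total: "(\<Sum>\<^sub>\<infinity>m. T m) < \<infinity>"
    using schauder_tail_0_finite[OF assms] by (simp add: schauder_tail_def T_def)
  have "T m < \<infinity>" for m
  proof -
    have "(\<Sum>\<^sub>\<infinity>m\<in>{m}. T m) \<le> (\<Sum>\<^sub>\<infinity>m. T m)"
      by (intro infsum_mono_neutral nonneg_summable_on_complete) auto
    then show ?thesis using total by (simp add: order.strict_trans1)
  qed
  then have T: "ennreal (enn2real (T m)) = T m" for m by (simp add: less_top)
  have "summable (\<lambda>m. enn2real (T m))"
    using finite_infsum_ennreal_imp_summable_on[of UNIV "\<lambda>m. enn2real (T m)"] total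
    by (simp add: T summable_on_imp_summable)
  define h where "h j = (case j of 0 \<Rightarrow> \<bar>fs_coeff f (-1) 0\<bar> | Suc m \<Rightarrow> enn2real (T m))" for j
  show ?thesis
  proof (rule that[of h])
    have "summable (\<lambda>m. h (Suc m))" using \<open>summable (\<lambda>m. enn2real (T m))\<close> by (simp add: h_def)
    then show "summable h" by (simp only: summable_Suc_iff)
    show "\<bar>schauder_block f j s\<bar> \<le> h j" if s: "s \<in> {0..1}" for j s
    proof (cases j)
      case 0
      then show ?thesis
        using s by (simp add: schauder_block_def level_idx_root schauder_root h_def abs_mult mult_left_le)
    next
      case (Suc m)
      obtain k where k: "k \<in> level_idx (int m)"
        "schauder_block f j s = fs_coeff f (int m) k * schauder (int m) k s"
        using blocks_at_active_index[OF s, of j f] Suc by auto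
      have "\<bar>schauder_block f j s\<bar> \<le> \<bar>fs_coeff f (int m) k\<bar> * 2 powr - (real m / 2)"
        unfolding k(2) abs_mult by (intro mult_left_mono abs_schauder_le s) simp
      also have "ennreal \<dots> \<le> T m"
      proof -
        have "ennreal \<bar>fs_coeff f (int m) k\<bar> \<le> (SUP k\<in>level_idx (int m). ennreal \<bar>fs_coeff f (int m) k\<bar>)"
          by (rule SUP_upper[OF k(1)])
        then show ?thesis unfolding T_def
          by (subst mult.commute) (auto simp: ennreal_mult intro: mult_left_mono)
      qed
      then have "\<bar>fs_coeff f (int m) k\<bar> * 2 powr - (real m / 2) \<le> enn2real (T m)"
        using ennreal_le_iff[OF enn2real_nonneg[of "T m"]] T[of m] by simp
      finally show ?thesis by (simp add: h_def Suc)
    qed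
  qed
qed

section \<open>Integrals of one block against another\<close>

lemma pw_primitive_abs_times_integrable_on:
  assumes "pw_primitive u u'" "pw_primitive v v'"
  shows "(\<lambda>s. \<bar>u' s\<bar> * \<bar>v' s\<bar>) integrable_on {a..b}"
proof -
  obtain B C where B: "\<And>s. \<bar>u' s\<bar> \<le> B" and C: "\<And>s. \<bar>v' s\<bar> \<le> C"
    using assms unfolding pw_primitive_def by blast
  show ?thesis
  proof (rule bounded_measurable_integrable_on)
    show "(\<lambda>s. \<bar>u' s\<bar> * \<bar>v' s\<bar>) \<in> borel_measurable (lebesgue_on {a..b})"
      using assms[THEN pw_primitive_measurable]
      by (intro borel_measurable_lebesgue_on borel_measurable_times borel_measurable_abs)
    show "\<bar>\<bar>u' s\<bar> * \<bar>v' s\<bar>\<bar> \<le> B * C" for s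
      using B[of s] C[of s] by (auto simp: abs_mult intro!: mult_mono order_trans[OF abs_ge_zero])
  qed
qed

abbreviation cross_energy :: "(real \<Rightarrow> real) \<Rightarrow> nat \<Rightarrow> (real \<Rightarrow> real) \<Rightarrow> nat \<Rightarrow> real" where
  "cross_energy f j g i \<equiv> integral {0..1} (\<lambda>s. \<bar>haar_block f j s\<bar> * \<bar>haar_block g i s\<bar>)"

text \<open>
  Young's inequality for the two Haar blocks, each first divided by the scale of its $L^p$ or $L^q$
  norm.  Stating the bound through the sum of the powers of the energies, instead of their product, costs
  nothing later and avoids Hoelder's inequality and Young's convolution inequality.
\<close>
lemma cross_energy_le:
  assumes pq: "p > 1" "q > 1" "1 / p + 1 / q = 1"
  shows "cross_energy f j g i \<le> 2 powr ((real j - 1) / q) * 2 powr ((real i - 1) / p) *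
    (level_energy p f (int j - 1) powr p + level_energy q g (int i - 1) powr q)"
    (is "_ \<le> ?A * ?B * (?X + ?Y)")
proof -
  let ?a = "2 powr (- ((real j - 1) / q))" and ?b = "2 powr (- ((real i - 1) / p))"
  have p_q: "p / q = p - 1" and q_p: "q / p = q - 1"
    using pq by (simp_all add: field_simps)
  have "((\<lambda>s. ?a powr p * \<bar>haar_block f j s\<bar> powr p) has_integral
      ?a powr p * (2 powr ((real j - 1) * (p - 1)) * ?X)) {0..1}"
    using pq by (intro has_integral_mult_right haar_block_powr_has_integral) simp
  moreover have "?a powr p * 2 powr ((real j - 1) * (p - 1)) = 1"
    unfolding p_q[symmetric] by (simp add: powr_powr powr_add[symmetric] mult.commute)
  ultimately have F: "((\<lambda>s. (?a * \<bar>haar_block f j s\<bar>) powr p) has_integral ?X) {0..1}"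
    by (simp add: powr_mult mult.assoc[symmetric])
  have "((\<lambda>s. ?b powr q * \<bar>haar_block g i s\<bar> powr q) has_integral
      ?b powr q * (2 powr ((real i - 1) * (q - 1)) * ?Y)) {0..1}"
    using pq by (intro has_integral_mult_right haar_block_powr_has_integral) simp
  moreover have "?b powr q * 2 powr ((real i - 1) * (q - 1)) = 1"
    unfolding q_p[symmetric] by (simp add: powr_powr powr_add[symmetric] mult.commute)
  ultimately have G: "((\<lambda>s. (?b * \<bar>haar_block g i s\<bar>) powr q) has_integral ?Y) {0..1}"
    by (simp add: powr_mult mult.assoc[symmetric])
  have "((\<lambda>s. \<bar>haar_block f j s\<bar> * \<bar>haar_block g i s\<bar>) has_integral cross_energy f j g i) {0..1}"
    by (intro integrable_integral pw_primitive_abs_times_integrable_on[OF pw_primitive_block pw_primitive_block])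
  then have "((\<lambda>s. (?a * ?b) * (\<bar>haar_block f j s\<bar> * \<bar>haar_block g i s\<bar>)) has_integral (?a * ?b) * cross_energy f j g i) {0..1}"
    by (rule has_integral_mult_right)
  then have "(?a * ?b) * cross_energy f j g i \<le> ?X + ?Y"
  proof (rule has_integral_le[OF _ has_integral_add[OF F G]])
    fix s
    let ?u = "?a * \<bar>haar_block f j s\<bar>" and ?v = "?b * \<bar>haar_block g i s\<bar>"
    have "?u * ?v \<le> ?u powr p / p + ?v powr q / q"
      by (intro Youngs_inequality pq) auto
    also have "\<dots> \<le> ?u powr p + ?v powr q"
      using pq by (intro add_mono) (auto simp: divide_le_eq mult_left_le mult_le_cancel_left1)
    finally show "(?a * ?b) * (\<bar>haar_block f j s\<bar> * \<bar>haar_block g i s\<bar>) \<le> ?u powr p + ?v powr q"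
      by (simp add: mult_ac)
  qed
  then have "(?A * ?B) * ((?a * ?b) * cross_energy f j g i) \<le> (?A * ?B) * (?X + ?Y)"
    by (intro mult_left_mono) auto
  also have "(?A * ?B) * ((?a * ?b) * cross_energy f j g i) = (?A * ?a) * (?B * ?b) * cross_energy f j g i"
    by (simp only: mult_ac)
  also have "(?A * ?a) * (?B * ?b) = 1" by (simp add: powr_add[symmetric])
  finally show ?thesis by simp
qed

lemma abs_integral_block_le:
  assumes t: "t \<in> {0..1}"
  shows "\<bar>integral {0..t} (\<lambda>s. schauder_block f j s * haar_block g i s)\<bar> \<le> cross_energy f j g i / 2 ^ j"
proof -
  let ?w = "\<lambda>s. \<bar>haar_block f j s\<bar> * \<bar>haar_block g i s\<bar>"
  have w: "?w integrable_on {a..b}" for a b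
    by (rule pw_primitive_abs_times_integrable_on[OF pw_primitive_block pw_primitive_block])
  have "norm (integral {0..t} (\<lambda>s. schauder_block f j s * haar_block g i s)) \<le> integral {0..t} (\<lambda>s. 1 / 2 ^ j * ?w s)"
  proof (rule integral_norm_bound_integral)
    show "(\<lambda>s. schauder_block f j s * haar_block g i s) integrable_on {0..t}"
      using t by (intro pw_primitive_times_integrable_on[OF _ pw_primitive_block]
          continuous_on_subset[OF pw_primitive_continuous[OF pw_primitive_block]]) auto
    show "(\<lambda>s. 1 / 2 ^ j * ?w s) integrable_on {0..t}"
      by (rule integrable_on_mult_right[OF w])
    show "norm (schauder_block f j s * haar_block g i s) \<le> 1 / 2 ^ j * ?w s" if "s \<in> {0..t}" for s
      using mult_right_mono[OF abs_schauder_block_le_haar_block[of s f j], of "\<bar>haar_block g i s\<bar>"] that t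
      by (simp add: abs_mult)
  qed
  then have "\<bar>integral {0..t} (\<lambda>s. schauder_block f j s * haar_block g i s)\<bar> \<le> 1 / 2 ^ j * integral {0..t} ?w"
    by simp
  also have "\<dots> \<le> 1 / 2 ^ j * integral {0..1} ?w"
    using t by (intro mult_left_mono integral_subset_le w) auto
  finally show ?thesis by simp
qed

text \<open>
  The direct bound divides by \<open>2 ^ j\<close>, from the integrand; when the integrator is the finer of the two,
  integration by parts divides by the larger \<open>2 ^ i\<close> instead, at the price of a boundary term.
\<close>
lemma abs_integral_block_by_parts_le:
  assumes t: "t \<in> {0..1}"
  shows "\<bar>integral {0..t} (\<lambda>s. schauder_block f j s * haar_block g i s)\<bar>
    \<le> \<bar>schauder_block f j t\<bar> * \<bar>schauder_block g i t\<bar> + cross_energy f j g i / 2 ^ i"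
proof -
  have "integral {0..t} (\<lambda>s. schauder_block f j s * haar_block g i s)
      = schauder_block f j t * schauder_block g i t
        - integral {0..t} (\<lambda>s. schauder_block g i s * haar_block f j s)"
    using pw_primitive_by_parts[OF pw_primitive_block pw_primitive_block, of t f j g i] t by simp
  moreover have "cross_energy g i f j = cross_energy f j g i"
    by (simp add: mult.commute)
  ultimately show ?thesis
    using abs_integral_block_le[OF t, of g i f j]
    by (simp add: abs_mult[symmetric])
qed

text \<open>
  A pair of levels at distance \<open>m\<close> decays at rate \<open>1 / p\<close> or \<open>1 / q\<close> according to which of \<open>f\<close> and \<open>g\<close> has
  the finer block; the worse of the two rates serves both cases.
\<close>
definition decay :: "real \<Rightarrow> real \<Rightarrow> real" where
  "decay p q = max (2 powr (- 1 / p)) (2 powr (- 1 / q))"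

lemma decay_bounds:
  assumes "p > 0" "q > 0"
  shows "0 < decay p q" "decay p q < 1"
  using assms by (auto simp: decay_def less_max_iff_disj powr_less_one)

lemma decay_power_ge:
  shows "2 powr (- (real m / p)) \<le> decay p q ^ m" "2 powr (- (real m / q)) \<le> decay p q ^ m"
proof -
  have "2 powr (- (real m / x)) = (2 powr (- 1 / x)) ^ m" for x :: real
    by (simp add: powr_realpow[symmetric] powr_powr)
  then show "2 powr (- (real m / p)) \<le> decay p q ^ m" "2 powr (- (real m / q)) \<le> decay p q ^ m"
    by (simp_all add: decay_def power_mono)
qed

text \<open>
  The exponent \<open>(j - i) + (i - j)\<close> is the distance of \<open>i\<close> and \<open>j\<close>, by truncated subtraction.  The
  power of 2 from \<open>cross_energy_le\<close>, divided by \<open>2 ^ max i j\<close>, decays in this distance because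
  \<open>1 / p + 1 / q = 1\<close>.
\<close>
lemma abs_block_integral_bound:
  assumes pq: "p > 1" "q > 1" "1 / p + 1 / q = 1" and t: "t \<in> {0..1}"
  shows "\<bar>integral {0..t} (\<lambda>s. schauder_block f j s * haar_block g i s)\<bar>
    \<le> \<bar>schauder_block f j t\<bar> * \<bar>schauder_block g i t\<bar> + decay p q ^ ((j - i) + (i - j)) *
      (level_energy p f (int j - 1) powr p + level_energy q g (int i - 1) powr q)"
    (is "_ \<le> ?P + _ * ?S")
proof -
  have S: "?S \<ge> 0" by simp
  let ?AB = "2 powr ((real j - 1) / q) * 2 powr ((real i - 1) / p)"
  have ip: "x / p = x * (1 - 1 / q)" and iq: "x / q = x * (1 - 1 / p)" for x
  proof -
    have e: "1 - 1 / q = 1 / p" "1 - 1 / p = 1 / q" using pq(3) by linarith+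
    show "x / p = x * (1 - 1 / q)" "x / q = x * (1 - 1 / p)" unfolding e by simp_all
  qed
  show ?thesis
  proof (cases "i \<le> j")
    case True
    have "?AB / 2 ^ j = 2 powr ((real j - 1) / q + (real i - 1) / p - real j)"
      by (simp add: powr_add powr_diff powr_realpow)
    also have "(real j - 1) / q + (real i - 1) / p - real j = - (real (j - i) / p) - 1"
      unfolding iq using True by (simp add: of_nat_diff algebra_simps diff_divide_distrib add_divide_distrib)
    also have "2 powr (- (real (j - i) / p) - 1) \<le> 2 powr (- (real (j - i) / p))" by (intro powr_mono) auto
    also have "\<dots> \<le> decay p q ^ (j - i)" by (rule decay_power_ge)
    finally have "?AB / 2 ^ j * ?S \<le> decay p q ^ (j - i) * ?S" by (intro mult_right_mono S)
    moreover have "cross_energy f j g i / 2 ^ j \<le> ?AB / 2 ^ j * ?S"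
      using divide_right_mono[OF cross_energy_le[OF pq, of f j g i], of "2 ^ j"] by simp
    moreover note abs_integral_block_le[OF t, of f j g i]
    moreover have "?P \<ge> 0" by simp
    moreover have e: "(j - i) + (i - j) = j - i" using True by simp
    ultimately show ?thesis unfolding e by linarith
  next
    case False
    have "?AB / 2 ^ i = 2 powr ((real j - 1) / q + (real i - 1) / p - real i)"
      by (simp add: powr_add powr_diff powr_realpow)
    also have "(real j - 1) / q + (real i - 1) / p - real i = - (real (i - j) / q) - 1"
      unfolding ip using False by (simp add: of_nat_diff algebra_simps diff_divide_distrib add_divide_distrib)
    also have "2 powr (- (real (i - j) / q) - 1) \<le> 2 powr (- (real (i - j) / q))" by (intro powr_mono) auto
    also have "\<dots> \<le> decay p q ^ (i - j)" by (rule decay_power_ge)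
    finally have "?AB / 2 ^ i * ?S \<le> decay p q ^ (i - j) * ?S" by (intro mult_right_mono S)
    moreover have "cross_energy f j g i / 2 ^ i \<le> ?AB / 2 ^ i * ?S"
      using divide_right_mono[OF cross_energy_le[OF pq, of f j g i], of "2 ^ i"] by simp
    moreover note abs_integral_block_by_parts_le[OF t, of f j g i]
    moreover have e: "(j - i) + (i - j) = i - j" using False by simp
    ultimately show ?thesis unfolding e by linarith
  qed
qed

section \<open>Summation over pairs of levels\<close>

lemma sum_geometric_distance_le:
  fixes r :: real
  assumes r: "0 \<le> r" "r < 1" and F: "finite F"
  shows "(\<Sum>i\<in>F. r ^ ((j - i) + (i - j))) \<le> 2 / (1 - r)"
proof -
  have geo: "(\<Sum>d\<in>D. r ^ d) \<le> 1 / (1 - r)" if "finite D" for D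
    using sum_le_suminf[of "\<lambda>d. r ^ d" D] that r suminf_geometric[of r] by (simp add: summable_geometric)
  have "(\<Sum>i\<in>F. r ^ ((j - i) + (i - j)))
      = (\<Sum>i\<in>F \<inter> {..j}. r ^ ((j - i) + (i - j))) + (\<Sum>i\<in>F \<inter> {j<..}. r ^ ((j - i) + (i - j)))"
    using F by (subst sum.union_disjoint[symmetric]) (auto intro!: sum.cong)
  also have "(\<Sum>i\<in>F \<inter> {..j}. r ^ ((j - i) + (i - j))) = (\<Sum>d\<in>(\<lambda>i. j - i) ` (F \<inter> {..j}). r ^ d)"
    by (subst sum.reindex) (auto simp: inj_on_def)
  also have "\<dots> \<le> 1 / (1 - r)" using F by (intro geo) auto
  also have "(\<Sum>i\<in>F \<inter> {j<..}. r ^ ((j - i) + (i - j))) = (\<Sum>d\<in>(\<lambda>i. i - j) ` (F \<inter> {j<..}). r ^ d)"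
    by (subst sum.reindex) (auto simp: inj_on_def)
  also have "\<dots> \<le> 1 / (1 - r)" using F by (intro geo) auto
  finally show ?thesis by simp
qed

text \<open>
  Every finite set of pairs lies in a product of two finite sets, so bounds on row sums suffice.
\<close>
lemma summable_on_pairs_if_rows_bounded:
  fixes w :: "nat \<times> nat \<Rightarrow> real"
  assumes nonneg: "\<And>x. w x \<ge> 0" and c: "summable c"
    and rows: "\<And>j F. finite F \<Longrightarrow> (\<Sum>i\<in>F. w (j, i)) \<le> c j"
  shows "w summable_on UNIV"
proof (rule nonneg_bdd_above_summable_on)
  have c_nonneg: "c j \<ge> 0" for j using rows[of "{}" j] by simp
  show "bdd_above (sum w ` {F. F \<subseteq> UNIV \<and> finite F})"
  proof (rule bdd_aboveI2)
    fix F :: "(nat \<times> nat) set" assume "F \<in> {F. F \<subseteq> UNIV \<and> finite F}"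
    then have F: "finite F" by simp
    have "sum w F \<le> sum w (fst ` F \<times> snd ` F)"
      using F by (intro sum_mono2) (auto simp: nonneg intro: rev_image_eqI)
    also have "\<dots> = (\<Sum>j\<in>fst ` F. \<Sum>i\<in>snd ` F. w (j, i))"
      by (simp add: sum.cartesian_product)
    also have "\<dots> \<le> (\<Sum>j\<in>fst ` F. c j)" using F by (intro sum_mono rows) simp
    also have "\<dots> \<le> suminf c" using F c_nonneg by (intro sum_le_suminf c) auto
    finally show "sum w F \<le> suminf c" .
  qed
qed (rule nonneg)

text \<open>
  The product part is a product of two convergent series.  In the other part one index is free
  apart from the geometric factor, whose sum over that index is bounded independently of the other.
\<close>
lemma summable_on_block_bounds:
  fixes h k X Y :: "nat \<Rightarrow> real" and r :: real
  assumes r: "0 \<le> r" "r < 1"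
    and h: "summable h" "\<And>j. h j \<ge> 0" and k: "summable k" "\<And>i. k i \<ge> 0"
    and X: "summable X" "\<And>j. X j \<ge> 0" and Y: "summable Y" "\<And>i. Y i \<ge> 0"
  shows "(\<lambda>(j, i). h j * k i + r ^ ((j - i) + (i - j)) * (X j + Y i)) summable_on UNIV"
proof -
  have near_diagonal: "(\<lambda>(j, i). r ^ ((j - i) + (i - j)) * Z j) summable_on UNIV"
    if Z: "summable Z" "\<And>j. Z j \<ge> 0" for Z :: "nat \<Rightarrow> real"
  proof (rule summable_on_pairs_if_rows_bounded[where c = "\<lambda>j. 2 / (1 - r) * Z j"])
    show "summable (\<lambda>j. 2 / (1 - r) * Z j)" by (intro summable_mult Z)
    show "(\<Sum>i\<in>F. case (j, i) of (j, i) \<Rightarrow> r ^ ((j - i) + (i - j)) * Z j) \<le> 2 / (1 - r) * Z j"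
      if "finite F" for j F
      using mult_right_mono[OF sum_geometric_distance_le[OF r that, of j] Z(2)[of j]]
      by (simp add: sum_distrib_right)
  qed (use r Z in auto)
  have "(\<lambda>(j, i). h j * k i) summable_on UNIV"
  proof (rule summable_on_pairs_if_rows_bounded[where c = "\<lambda>j. h j * suminf k"])
    show "summable (\<lambda>j. h j * suminf k)" by (intro summable_mult2 h)
    show "(\<Sum>i\<in>F. case (j, i) of (j, i) \<Rightarrow> h j * k i) \<le> h j * suminf k" if "finite F" for j F
      using mult_left_mono[OF sum_le_suminf[OF k(1) that] h(2)[of j]] k(2)
      by (simp add: sum_distrib_left)
  qed (use h k in auto)
  moreover note near_diagonal[OF X]
  moreover have "(\<lambda>(j, i). r ^ ((j - i) + (i - j)) * Y i) summable_on UNIV"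
    using near_diagonal[OF Y]
    by (subst UNIV_Times_UNIV[symmetric], subst summable_on_swap) (simp add: add.commute)
  ultimately have "(\<lambda>x. (\<lambda>(j, i). h j * k i) x + ((\<lambda>(j, i). r ^ ((j - i) + (i - j)) * X j) x
      + (\<lambda>(j, i). r ^ ((j - i) + (i - j)) * Y i) x)) summable_on UNIV"
    by (intro summable_on_add)
  then show ?thesis by (simp add: case_prod_unfold algebra_simps)
qed

section \<open>Dyadic left sums\<close>

lemma left_sum_at_dyadic:
  "left_sum f g (dyadic_pt n K) n
     = (\<Sum>k<K. f (dyadic_pt n k) * (g (dyadic_pt n (Suc k)) - g (dyadic_pt n k)))"
  by (simp add: left_sum_def dyadic_pt_def)

text \<open>
  On a cell \<open>fs_trunc n f\<close> is affine, so it differs from its value at the left end by at most the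
  cell length times the slope.  The bound may fail at the right end point, where the Haar
  blocks no longer take the slope of this cell; this point is negligible.
\<close>
lemma abs_cell_error_le:
  assumes k: "k < 2 ^ n"
  shows "\<bar>integral {dyadic_pt n k..dyadic_pt n (Suc k)} (\<lambda>s. fs_trunc n f s * haar_sum n g s)
      - f (dyadic_pt n k) * (g (dyadic_pt n (Suc k)) - g (dyadic_pt n k))\<bar>
    \<le> integral {dyadic_pt n k..dyadic_pt n (Suc k)} (\<lambda>s. \<bar>haar_sum n f s\<bar> * \<bar>haar_sum n g s\<bar>) / 2 ^ n"
proof -
  let ?a = "dyadic_pt n k" and ?b = "dyadic_pt n (Suc k)"
  let ?w = "\<lambda>s. \<bar>haar_sum n f s\<bar> * \<bar>haar_sum n g s\<bar>"
  note b = dyadic_pt_bounds[OF k]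
  have w: "?w integrable_on {?a..?b}"
    by (rule pw_primitive_abs_times_integrable_on[OF pw_primitive_fs_trunc pw_primitive_fs_trunc])
  have dg: "(haar_sum n g has_integral g ?b - g ?a) {?a..?b}"
    using pw_primitive_FTC[OF pw_primitive_fs_trunc[of n g], of ?a ?b] b k
    by (simp add: fs_trunc_interpolates)
  have fg: "(\<lambda>s. fs_trunc n f s * haar_sum n g s) integrable_on {?a..?b}"
    using b by (intro pw_primitive_times_integrable_on[OF _ pw_primitive_fs_trunc]
        continuous_on_subset[OF pw_primitive_continuous[OF pw_primitive_fs_trunc]]) auto
  have diff: "((\<lambda>s. fs_trunc n f s * haar_sum n g s - f ?a * haar_sum n g s) has_integral
      integral {?a..?b} (\<lambda>s. fs_trunc n f s * haar_sum n g s) - f ?a * (g ?b - g ?a)) {?a..?b}"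
    by (intro has_integral_diff has_integral_mult_right dg integrable_integral fg)
  have bound: "\<bar>fs_trunc n f s * haar_sum n g s - f ?a * haar_sum n g s\<bar> \<le> 1 / 2 ^ n * ?w s"
    if s: "s \<in> {?a..<?b}" for s
  proof -
    have const: "haar_sum n f s = haar_sum n f ?a"
      by (intro sum.cong refl haar_block_constant_on_cell[OF _ k s]) simp
    have "fs_trunc n f s - f ?a = (s - ?a) * haar_sum n f s"
      using fs_trunc_affine_on_cell[OF k, of s f] s k by (simp add: const fs_trunc_interpolates)
    moreover have "\<bar>s - ?a\<bar> \<le> 1 / 2 ^ n"
      using s by (auto simp: dyadic_pt_def add_divide_distrib)
    ultimately have "\<bar>fs_trunc n f s - f ?a\<bar> \<le> 1 / 2 ^ n * \<bar>haar_sum n f s\<bar>"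
      by (simp only: abs_mult mult_right_mono abs_ge_zero)
    from mult_right_mono[OF this, of "\<bar>haar_sum n g s\<bar>"] show ?thesis
      by (simp add: abs_mult[symmetric] left_diff_distrib mult.assoc)
  qed
  \<comment> \<open>At the right end point the integrand is replaced by 0, so that the pointwise bound holds on the closed cell.\<close>
  have spike: "negligible {?b}" by simp
  have "norm (integral {?a..?b} (\<lambda>s. if s = ?b then 0 else fs_trunc n f s * haar_sum n g s - f ?a * haar_sum n g s))
      \<le> integral {?a..?b} (\<lambda>s. 1 / 2 ^ n * ?w s)"
  proof (rule integral_norm_bound_integral)
    show "(\<lambda>s. if s = ?b then 0 else fs_trunc n f s * haar_sum n g s - f ?a * haar_sum n g s) integrable_on {?a..?b}"
      by (rule integrable_spike[OF has_integral_integrable[OF diff] spike]) simp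
    show "(\<lambda>s. 1 / 2 ^ n * ?w s) integrable_on {?a..?b}" by (rule integrable_on_mult_right[OF w])
    show "norm (if s = ?b then 0 else fs_trunc n f s * haar_sum n g s - f ?a * haar_sum n g s) \<le> 1 / 2 ^ n * ?w s"
      if "s \<in> {?a..?b}" for s
      using bound[of s] that by auto
  qed
  also have "integral {?a..?b} (\<lambda>s. if s = ?b then 0 else fs_trunc n f s * haar_sum n g s - f ?a * haar_sum n g s)
      = integral {?a..?b} (\<lambda>s. fs_trunc n f s * haar_sum n g s - f ?a * haar_sum n g s)"
    by (rule integral_spike[OF spike]) simp
  also have "\<dots> = integral {?a..?b} (\<lambda>s. fs_trunc n f s * haar_sum n g s) - f ?a * (g ?b - g ?a)"
    by (rule integral_unique[OF diff])
  finally show ?thesis by simp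
qed

lemma abs_left_sum_error_le:
  assumes "K \<le> 2 ^ n"
  shows "\<bar>integral {0..dyadic_pt n K} (\<lambda>s. fs_trunc n f s * haar_sum n g s) - left_sum f g (dyadic_pt n K) n\<bar>
    \<le> integral {0..dyadic_pt n K} (\<lambda>s. \<bar>haar_sum n f s\<bar> * \<bar>haar_sum n g s\<bar>) / 2 ^ n"
  using assms
proof (induction K)
  case 0
  have "dyadic_pt n 0 = 0" by (simp add: dyadic_pt_def)
  then show ?case using left_sum_at_dyadic[of f g n 0] by simp
next
  case (Suc K)
  let ?a = "dyadic_pt n K" and ?b = "dyadic_pt n (Suc K)"
  let ?w = "\<lambda>s. \<bar>haar_sum n f s\<bar> * \<bar>haar_sum n g s\<bar>" and ?v = "\<lambda>s. fs_trunc n f s * haar_sum n g s"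
  have K: "K < 2 ^ n" using Suc.prems by simp
  note b = dyadic_pt_bounds[OF K]
  have "?w integrable_on {0..?b}"
    by (rule pw_primitive_abs_times_integrable_on[OF pw_primitive_fs_trunc pw_primitive_fs_trunc])
  then have w: "integral {0..?b} ?w = integral {0..?a} ?w + integral {?a..?b} ?w"
    using Henstock_Kurzweil_Integration.integral_combine[of 0 ?a ?b ?w] b by simp
  have "?v integrable_on {0..?b}"
    using b by (intro pw_primitive_times_integrable_on[OF _ pw_primitive_fs_trunc]
        continuous_on_subset[OF pw_primitive_continuous[OF pw_primitive_fs_trunc]]) auto
  then have v: "integral {0..?b} ?v = integral {0..?a} ?v + integral {?a..?b} ?v"
    using Henstock_Kurzweil_Integration.integral_combine[of 0 ?a ?b ?v] b by simp
  have "left_sum f g ?b n = left_sum f g ?a n + f ?a * (g ?b - g ?a)"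
    by (simp add: left_sum_at_dyadic)
  then show ?case
    using Suc.IH K abs_cell_error_le[OF K, of f g] unfolding v w add_divide_distrib by linarith
qed

text \<open>
  The bound on the left-sum error, expanded into pairs of blocks.  Splitting \<open>2 ^ n\<close> by
  \<open>1 / p + 1 / q = 1\<close> lets each level be damped by its own distance to \<open>n\<close>, which leaves two
  convolutions of a summable sequence with a geometric one.
\<close>
lemma energy_of_sums_le:
  assumes pq: "p > 1" "q > 1" "1 / p + 1 / q = 1"
  defines "r \<equiv> decay p q"
  shows "integral {0..1} (\<lambda>s. \<bar>haar_sum n f s\<bar> * \<bar>haar_sum n g s\<bar>) / 2 ^ n
    \<le> 1 / (1 - r) * ((\<Sum>j\<le>n. level_energy p f (int j - 1) powr p * r ^ (n - j))
                     + (\<Sum>i\<le>n. level_energy q g (int i - 1) powr q * r ^ (n - i)))"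
proof -
  let ?X = "\<lambda>j. level_energy p f (int j - 1) powr p" and ?Y = "\<lambda>i. level_energy q g (int i - 1) powr q"
  have r: "0 < r" "r < 1" using decay_bounds[of p q] pq by (auto simp: r_def)
  have int: "(\<lambda>s. \<bar>haar_block f j s\<bar> * \<bar>haar_block g i s\<bar>) integrable_on {0..1}" for j i
    by (rule pw_primitive_abs_times_integrable_on[OF pw_primitive_block pw_primitive_block])
  have "integral {0..1} (\<lambda>s. \<bar>haar_sum n f s\<bar> * \<bar>haar_sum n g s\<bar>)
      \<le> integral {0..1} (\<lambda>s. \<Sum>j\<le>n. \<Sum>i\<le>n. \<bar>haar_block f j s\<bar> * \<bar>haar_block g i s\<bar>)"
  proof (rule integral_le)
    show "(\<lambda>s. \<bar>haar_sum n f s\<bar> * \<bar>haar_sum n g s\<bar>) integrable_on {0..1}"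
      by (rule pw_primitive_abs_times_integrable_on[OF pw_primitive_fs_trunc pw_primitive_fs_trunc])
    show "\<bar>haar_sum n f s\<bar> * \<bar>haar_sum n g s\<bar> \<le> (\<Sum>j\<le>n. \<Sum>i\<le>n. \<bar>haar_block f j s\<bar> * \<bar>haar_block g i s\<bar>)" for s
      unfolding sum_product[symmetric] by (intro mult_mono sum_abs sum_nonneg abs_ge_zero)
  qed (intro integrable_sum int finite_atMost)
  also have "\<dots> = (\<Sum>j\<le>n. \<Sum>i\<le>n. cross_energy f j g i)"
    by (simp add: integral_sum integrable_sum int)
  finally have "integral {0..1} (\<lambda>s. \<bar>haar_sum n f s\<bar> * \<bar>haar_sum n g s\<bar>) / 2 ^ n
      \<le> (\<Sum>j\<le>n. \<Sum>i\<le>n. cross_energy f j g i / 2 ^ n)"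
    by (simp add: sum_divide_distrib[symmetric] divide_right_mono)
  also have "\<dots> \<le> (\<Sum>j\<le>n. \<Sum>i\<le>n. r ^ (n - j) * r ^ (n - i) * (?X j + ?Y i))"
  proof (intro sum_mono)
    fix j i assume ji: "j \<in> {..n}" "i \<in> {..n}"
    have weight: "2 powr ((real m - 1) / x) / 2 powr (real n / x) \<le> r ^ (n - m)"
      if "m \<le> n" "x = p \<or> x = q" for m x
    proof -
      have "x > 0" using that pq by auto
      have "(real m - 1) / x - real n / x \<le> - (real (n - m) / x)"
        using that \<open>x > 0\<close> by (simp add: of_nat_diff divide_simps)
      then have "2 powr ((real m - 1) / x) / 2 powr (real n / x) \<le> 2 powr (- (real (n - m) / x))"
        by (simp add: powr_diff[symmetric])
      also have "\<dots> \<le> r ^ (n - m)" using that(2) decay_power_ge[of "n - m"] unfolding r_def by blast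
      finally show ?thesis .
    qed
    have "real n = real n / q + real n / p"
      using pq(3) by (metis add.commute distrib_left mult.right_neutral times_divide_eq_right)
    then have split: "(2::real) ^ n = 2 powr (real n / q) * 2 powr (real n / p)"
      by (metis powr_add powr_realpow zero_less_numeral)
    have "cross_energy f j g i / 2 ^ n
        \<le> 2 powr ((real j - 1) / q) * 2 powr ((real i - 1) / p) * (?X j + ?Y i) / 2 ^ n"
      by (intro divide_right_mono cross_energy_le pq) simp
    also have "\<dots> = (2 powr ((real j - 1) / q) / 2 powr (real n / q))
        * (2 powr ((real i - 1) / p) / 2 powr (real n / p)) * (?X j + ?Y i)"
      by (simp add: split)
    also have "\<dots> \<le> r ^ (n - j) * r ^ (n - i) * (?X j + ?Y i)"
      using ji r by (intro mult_right_mono mult_mono weight) auto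
    finally show "cross_energy f j g i / 2 ^ n \<le> r ^ (n - j) * r ^ (n - i) * (?X j + ?Y i)" .
  qed
  also have "\<dots> = (\<Sum>i\<le>n. r ^ (n - i)) * (\<Sum>j\<le>n. ?X j * r ^ (n - j))
      + (\<Sum>j\<le>n. r ^ (n - j)) * (\<Sum>i\<le>n. ?Y i * r ^ (n - i))"
    unfolding sum_product sum.swap[of "\<lambda>i j. r ^ (n - i) * (?X j * r ^ (n - j))"] sum.distrib[symmetric]
    by (intro sum.cong refl) (simp add: algebra_simps)
  also have "\<dots> \<le> 1 / (1 - r) * (\<Sum>j\<le>n. ?X j * r ^ (n - j)) + 1 / (1 - r) * (\<Sum>i\<le>n. ?Y i * r ^ (n - i))"
  proof -
    have "(\<Sum>i\<le>n. r ^ (n - i)) = (\<Sum>i\<le>n. r ^ i)"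
      by (rule sum.reindex_bij_witness[of _ "\<lambda>i. n - i" "\<lambda>i. n - i"]) auto
    also have "\<dots> \<le> (\<Sum>i. r ^ i)" using r by (intro sum_le_suminf) auto
    also have "\<dots> = 1 / (1 - r)" using r by (simp add: suminf_geometric)
    finally have "(\<Sum>i\<le>n. r ^ (n - i)) \<le> 1 / (1 - r)" .
    then show ?thesis
      using r by (intro add_mono mult_right_mono sum_nonneg) auto
  qed
  finally show ?thesis by (simp add: distrib_left)
qed

text \<open>
  The convolutions are the terms of convergent Cauchy product series, so they tend to 0.
\<close>
lemma energy_of_sums_null:
  assumes pq: "p > 1" "q > 1" "1 / p + 1 / q = 1"
    and f: "f \<in> energy_space p" and g: "g \<in> energy_space q"
  shows "(\<lambda>n. integral {0..1} (\<lambda>s. \<bar>haar_sum n f s\<bar> * \<bar>haar_sum n g s\<bar>) / 2 ^ n) \<longlonglongrightarrow> 0"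
proof -
  have r: "0 < decay p q" "decay p q < 1" using decay_bounds[of p q] pq by auto
  have conv: "(\<lambda>n. \<Sum>j\<le>n. Z j * decay p q ^ (n - j)) \<longlonglongrightarrow> 0"
    if "summable Z" "\<And>j. Z j \<ge> 0" for Z :: "nat \<Rightarrow> real"
    using that r by (intro summable_LIMSEQ_zero summable_Cauchy_product) auto
  have upper: "(\<lambda>n. 1 / (1 - decay p q) * ((\<Sum>j\<le>n. level_energy p f (int j - 1) powr p * decay p q ^ (n - j))
                     + (\<Sum>i\<le>n. level_energy q g (int i - 1) powr q * decay p q ^ (n - i)))) \<longlonglongrightarrow> 1 / (1 - decay p q) * (0 + 0)"
    by (intro tendsto_intros conv summable_level_energies[OF f] summable_level_energies[OF g]) auto
  show ?thesis
  proof (rule tendsto_sandwich[OF _ _ tendsto_const])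
    show "\<forall>\<^sub>F n in sequentially. 0 \<le> integral {0..1} (\<lambda>s. \<bar>haar_sum n f s\<bar> * \<bar>haar_sum n g s\<bar>) / 2 ^ n"
      by (intro always_eventually allI divide_nonneg_nonneg Henstock_Kurzweil_Integration.integral_nonneg
          pw_primitive_abs_times_integrable_on[OF pw_primitive_fs_trunc pw_primitive_fs_trunc]) auto
    show "\<forall>\<^sub>F n in sequentially. integral {0..1} (\<lambda>s. \<bar>haar_sum n f s\<bar> * \<bar>haar_sum n g s\<bar>) / 2 ^ n
      \<le> 1 / (1 - decay p q) * ((\<Sum>j\<le>n. level_energy p f (int j - 1) powr p * decay p q ^ (n - j))
                     + (\<Sum>i\<le>n. level_energy q g (int i - 1) powr q * decay p q ^ (n - i)))"
      by (intro always_eventually allI energy_of_sums_le[OF pq])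
  qed (use upper in simp)
qed

section \<open>Convergence of the truncated integrals\<close>

lemma integral_fs_trunc_eq_block_sums:
  assumes t: "t \<in> {0..1}"
  shows "integral {0..t} (\<lambda>s. fs_trunc N f s * haar_sum M g s)
    = f 0 * (\<Sum>i\<le>M. schauder_block g i t)
      + (\<Sum>(j, i)\<in>{..N} \<times> {..M}. integral {0..t} (\<lambda>s. schauder_block f j s * haar_block g i s))"
proof -
  have D: "(haar_block g i has_integral schauder_block g i t) {0..t}" for i
    using pw_primitive_FTC[OF pw_primitive_block[of g i], of 0 t] t by simp
  have P: "((\<lambda>s. schauder_block f j s * haar_block g i s) has_integral
      integral {0..t} (\<lambda>s. schauder_block f j s * haar_block g i s)) {0..t}" for j i
    using t by (intro integrable_integral pw_primitive_times_integrable_on[OF _ pw_primitive_block]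
          continuous_on_subset[OF pw_primitive_continuous[OF pw_primitive_block]]) auto
  have "((\<lambda>s. f 0 * (\<Sum>i\<le>M. haar_block g i s)
          + (\<Sum>x\<in>{..N} \<times> {..M}. schauder_block f (fst x) s * haar_block g (snd x) s)) has_integral
      f 0 * (\<Sum>i\<le>M. schauder_block g i t)
      + (\<Sum>x\<in>{..N} \<times> {..M}. integral {0..t} (\<lambda>s. schauder_block f (fst x) s * haar_block g (snd x) s))) {0..t}"
    by (intro has_integral_add has_integral_mult_right has_integral_sum D P) auto
  moreover have "fs_trunc N f s * haar_sum M g s = f 0 * (\<Sum>i\<le>M. haar_block g i s)
          + (\<Sum>x\<in>{..N} \<times> {..M}. schauder_block f (fst x) s * haar_block g (snd x) s)" for s
    by (simp add: fs_trunc_eq distrib_right sum_product sum.cartesian_product case_prod_unfold)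
  ultimately show ?thesis by (simp add: integral_unique case_prod_unfold)
qed

text \<open>
  The block integrals are dominated, uniformly in \<open>t\<close>, by a summable family on all pairs of levels,
  so the Weierstrass test applies to arbitrary finite sets of pairs; rectangles \<open>{..N} \<times> {..M}\<close>
  exhaust the pairs when \<open>N\<close> and \<open>M\<close> tend to infinity independently.
\<close>
lemma uniform_limit_fs_trunc_integral:
  assumes pq: "p > 1" "q > 1" "1 / p + 1 / q = 1"
    and f: "f \<in> energy_space p" and g: "g \<in> energy_space q"
  obtains F where "uniform_limit {0..1}
    (\<lambda>(N, M) t. integral {0..t} (\<lambda>s. fs_trunc N f s * haar_sum M g s)) F (sequentially \<times>\<^sub>F sequentially)"
proof -
  obtain hf where hf: "summable hf" "\<And>j s. s \<in> {0..1} \<Longrightarrow> \<bar>schauder_block f j s\<bar> \<le> hf j"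
    using summable_block_bound[OF f] by blast
  obtain hg where hg: "summable hg" "\<And>i s. s \<in> {0..1} \<Longrightarrow> \<bar>schauder_block g i s\<bar> \<le> hg i"
    using summable_block_bound[OF g] by blast
  have nonneg: "hf j \<ge> 0" "hg i \<ge> 0" for j i
    using hf(2)[of 0 j] hg(2)[of 0 i] by auto
  let ?a = "\<lambda>(j, i) t. integral {0..t} (\<lambda>s. schauder_block f j s * haar_block g i s)"
  let ?b = "\<lambda>(j, i). hf j * hg i + decay p q ^ ((j - i) + (i - j)) *
      (level_energy p f (int j - 1) powr p + level_energy q g (int i - 1) powr q)"
  have r: "0 \<le> decay p q" "decay p q < 1"
    using decay_bounds[of p q] pq by auto
  have b: "?b summable_on UNIV"
    by (intro summable_on_block_bounds r hf(1) hg(1) nonneg summable_level_energies[OF f]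
        summable_level_energies[OF g]) auto
  have a_le_b: "norm (?a x t) \<le> ?b x" if "t \<in> {0..1}" for x t
  proof (cases x)
    case (Pair j i)
    have "\<bar>schauder_block f j t\<bar> * \<bar>schauder_block g i t\<bar> \<le> hf j * hg i"
      using hf(2)[OF that] hg(2)[OF that] nonneg by (intro mult_mono) auto
    then show ?thesis
      using abs_block_integral_bound[OF pq that, of f j g i] by (simp add: Pair)
  qed
  have pairs: "filterlim (\<lambda>(N, M). {..N} \<times> {..M}) (finite_subsets_at_top (UNIV :: (nat \<times> nat) set))
      (sequentially \<times>\<^sub>F sequentially)"
    unfolding filterlim_finite_subsets_at_top
  proof (intro allI impI)
    fix X :: "(nat \<times> nat) set" assume "finite X \<and> X \<subseteq> UNIV"
    then have X: "finite (fst ` X)" "finite (snd ` X)" by auto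
    obtain A B where "\<And>j. j \<in> fst ` X \<Longrightarrow> j \<le> A" "\<And>i. i \<in> snd ` X \<Longrightarrow> i \<le> B"
      using X[unfolded finite_nat_set_iff_bounded_le] by blast
    then have "X \<subseteq> {..A} \<times> {..B}" by force
    then have "X \<subseteq> {..N} \<times> {..M}" if "N \<ge> max A B" "M \<ge> max A B" for N M
      using that by fastforce
    then show "\<forall>\<^sub>F y in sequentially \<times>\<^sub>F sequentially.
        finite (case y of (N, M) \<Rightarrow> {..N} \<times> {..M}) \<and> X \<subseteq> (case y of (N, M) \<Rightarrow> {..N} \<times> {..M})
        \<and> (case y of (N, M) \<Rightarrow> {..N} \<times> {..M}) \<subseteq> UNIV"
      unfolding eventually_prod_sequentially by (intro exI[of _ "max A B"]) auto
  qed
  have "uniform_limit {0..1} (\<lambda>X t. \<Sum>x\<in>X. ?a x t) (\<lambda>t. \<Sum>\<^sub>\<infinity>x. ?a x t) (finite_subsets_at_top UNIV)"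
    by (rule Weierstrass_m_test_general[OF a_le_b b])
  from filterlim_compose[OF this pairs]
  have double: "uniform_limit {0..1} (\<lambda>y t. \<Sum>x\<in>(case y of (N, M) \<Rightarrow> {..N} \<times> {..M}). ?a x t)
      (\<lambda>t. \<Sum>\<^sub>\<infinity>x. ?a x t) (sequentially \<times>\<^sub>F sequentially)" .
  have initial: "filterlim (\<lambda>(N, M). {..M}) (finite_subsets_at_top (UNIV :: nat set))
      (sequentially \<times>\<^sub>F sequentially)"
    unfolding filterlim_finite_subsets_at_top
  proof (intro allI impI)
    fix X :: "nat set" assume "finite X \<and> X \<subseteq> UNIV"
    then obtain B where "\<And>i. i \<in> X \<Longrightarrow> i \<le> B"
      unfolding finite_nat_set_iff_bounded_le by blast
    then show "\<forall>\<^sub>F y in sequentially \<times>\<^sub>F sequentially.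
        finite (case y of (N, M) \<Rightarrow> {..M}) \<and> X \<subseteq> (case y of (N, M) \<Rightarrow> {..M})
        \<and> (case y of (N, M) \<Rightarrow> {..M}) \<subseteq> UNIV"
      unfolding eventually_prod_sequentially by (intro exI[of _ B]) force
  qed
  have "uniform_limit {0..1} (\<lambda>X t. \<Sum>i\<in>X. f 0 * schauder_block g i t)
      (\<lambda>t. \<Sum>\<^sub>\<infinity>i. f 0 * schauder_block g i t) (finite_subsets_at_top UNIV)"
  proof (rule Weierstrass_m_test_general)
    show "norm (f 0 * schauder_block g i t) \<le> \<bar>f 0\<bar> * hg i" if "t \<in> {0..1}" for i t
      using hg(2)[OF that] by (simp add: abs_mult mult_left_mono)
    have "summable (\<lambda>i. \<bar>f 0\<bar> * hg i)" by (intro summable_mult hg)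
    then show "(\<lambda>i. \<bar>f 0\<bar> * hg i) summable_on UNIV"
      using nonneg by (subst summable_on_UNIV_nonneg_real_iff) auto
  qed
  from filterlim_compose[OF this initial]
  have single: "uniform_limit {0..1} (\<lambda>y t. \<Sum>i\<in>(case y of (N, M) \<Rightarrow> {..M}). f 0 * schauder_block g i t)
      (\<lambda>t. \<Sum>\<^sub>\<infinity>i. f 0 * schauder_block g i t) (sequentially \<times>\<^sub>F sequentially)" .
  have "uniform_limit {0..1}
      (\<lambda>y t. (\<Sum>i\<in>(case y of (N, M) \<Rightarrow> {..M}). f 0 * schauder_block g i t)
           + (\<Sum>x\<in>(case y of (N, M) \<Rightarrow> {..N} \<times> {..M}). ?a x t))
      (\<lambda>t. (\<Sum>\<^sub>\<infinity>i. f 0 * schauder_block g i t) + (\<Sum>\<^sub>\<infinity>x. ?a x t)) (sequentially \<times>\<^sub>F sequentially)"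
    by (rule uniform_limit_add[OF single double])
  also have "?this \<longleftrightarrow> uniform_limit {0..1}
      (\<lambda>(N, M) t. integral {0..t} (\<lambda>s. fs_trunc N f s * haar_sum M g s))
      (\<lambda>t. (\<Sum>\<^sub>\<infinity>i. f 0 * schauder_block g i t) + (\<Sum>\<^sub>\<infinity>x. ?a x t)) (sequentially \<times>\<^sub>F sequentially)"
    by (intro uniform_limit_cong always_eventually allI ballI refl)
       (auto simp: integral_fs_trunc_eq_block_sums sum_distrib_left[symmetric] split: prod.split intro!: sum.cong)
  finally show ?thesis by (rule that)
qed

lemma dyadic_level_grid:
  assumes "t \<in> dyadics"
  obtains K where "K \<le> 2 ^ (dyadic_level t + i)" "t = dyadic_pt (dyadic_level t + i) K"
proof -
  let ?l = "dyadic_level t"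
  obtain m where "t \<in> dyadic_grid m" using assms by (auto simp: dyadics_def)
  then have "t \<in> dyadic_grid ?l" unfolding dyadic_level_def by (rule LeastI)
  then obtain K where K: "K \<le> 2 ^ ?l" "t = dyadic_pt ?l K" by (auto simp: dyadic_grid_def)
  show ?thesis
  proof (rule that[of "K * 2 ^ i"])
    show "K * 2 ^ i \<le> 2 ^ (?l + i)" using K(1) by (simp add: power_add)
    show "t = dyadic_pt (?l + i) (K * 2 ^ i)"
      unfolding K(2)[unfolded dyadic_pt_def, symmetric]
      using K(2) by (simp add: dyadic_pt_def power_add)
  qed
qed

lemma dyadics_subset: "dyadics \<subseteq> {0..1}"
proof
  fix t assume "t \<in> dyadics"
  then obtain n k where k: "k \<le> 2 ^ n" "t = dyadic_pt n k"
    by (auto simp: dyadics_def dyadic_grid_def)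
  have "real k \<le> real (2 ^ n)" using k(1) by (rule of_nat_mono)
  then show "t \<in> {0..1}" by (simp add: k(2) dyadic_pt_def)
qed

text \<open>
  At a grid point the left sum and the integral of the diagonal truncations have the same limit,
  because their difference is at most the null sequence of \<open>energy_of_sums_null\<close>.
\<close>
lemma dyadic_sums_tendsto:
  assumes pq: "p > 1" "q > 1" "1 / p + 1 / q = 1"
    and f: "f \<in> energy_space p" and g: "g \<in> energy_space q" and t: "t \<in> dyadics"
    and lim: "(\<lambda>n. integral {0..t} (\<lambda>s. fs_trunc n f s * haar_sum n g s)) \<longlonglongrightarrow> L"
  shows "dyadic_sums f g t \<longlonglongrightarrow> L"
proof -
  let ?l = "dyadic_level t"
  let ?A = "\<lambda>n. integral {0..t} (\<lambda>s. fs_trunc n f s * haar_sum n g s)"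
  let ?E = "\<lambda>n. integral {0..1} (\<lambda>s. \<bar>haar_sum n f s\<bar> * \<bar>haar_sum n g s\<bar>) / 2 ^ n"
  have shift: "(\<lambda>i. X (?l + i)) \<longlonglongrightarrow> x" if "X \<longlonglongrightarrow> x" for X and x :: real
    using LIMSEQ_ignore_initial_segment[OF that, of ?l] by (simp add: add.commute)
  have error: "norm (?A (?l + i) - dyadic_sums f g t i) \<le> ?E (?l + i)" for i
  proof -
    let ?n = "?l + i"
    obtain K where K: "K \<le> 2 ^ ?n" "t = dyadic_pt ?n K"
      by (rule dyadic_level_grid[OF t])
    have "norm (?A ?n - dyadic_sums f g t i)
        \<le> integral {0..t} (\<lambda>s. \<bar>haar_sum ?n f s\<bar> * \<bar>haar_sum ?n g s\<bar>) / 2 ^ ?n"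
      using abs_left_sum_error_le[OF K(1), of f g] unfolding K(2)[symmetric] by (simp add: dyadic_sums_def)
    also have "\<dots> \<le> ?E ?n"
      using t dyadics_subset
      by (intro divide_right_mono integral_subset_le
          pw_primitive_abs_times_integrable_on[OF pw_primitive_fs_trunc pw_primitive_fs_trunc]) auto
    finally show ?thesis .
  qed
  have "(\<lambda>i. ?A (?l + i) - dyadic_sums f g t i) \<longlonglongrightarrow> 0"
    by (rule Lim_null_comparison[OF always_eventually shift[OF energy_of_sums_null[OF pq f g]]])
       (use error in blast)
  from tendsto_diff[OF shift[OF lim] this] show ?thesis by simp
qed

lemma continuous_eq_if_eq_on_dyadics:
  fixes F G :: "real \<Rightarrow> real"
  assumes F: "continuous_on {0..1} F" and G: "continuous_on {0..1} G"
    and eq: "\<And>t. t \<in> dyadics \<Longrightarrow> F t = G t" and t: "t \<in> {0..1}"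
  shows "F t = G t"
proof -
  \<comment> \<open>The dyadic points just below \<open>t\<close>.\<close>
  define u where "u n = dyadic_pt n (nat \<lfloor>2 ^ n * t\<rfloor>)" for n
  have u_eq: "u n = real_of_int \<lfloor>2 ^ n * t\<rfloor> / 2 ^ n" for n
    using t by (simp add: u_def dyadic_pt_def)
  have u: "u n \<in> dyadics" for n
  proof -
    have "\<lfloor>2 ^ n * t\<rfloor> \<le> \<lfloor>2 ^ n :: real\<rfloor>" using t by (intro floor_mono) (simp add: mult_left_le)
    then have "nat \<lfloor>2 ^ n * t\<rfloor> \<le> 2 ^ n" by (simp add: nat_le_iff floor_power)
    then have "u n \<in> dyadic_grid n" unfolding u_def dyadic_grid_def by (intro imageI) simp
    then show ?thesis by (auto simp: dyadics_def)
  qed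
  have "norm (u n - t) \<le> (1 / 2) ^ n" for n
  proof -
    have "\<bar>real_of_int \<lfloor>2 ^ n * t\<rfloor> - 2 ^ n * t\<bar> \<le> 1" by linarith
    then have "\<bar>real_of_int \<lfloor>2 ^ n * t\<rfloor> - 2 ^ n * t\<bar> / 2 ^ n \<le> 1 / 2 ^ n" by (rule divide_right_mono) simp
    moreover have "u n - t = (real_of_int \<lfloor>2 ^ n * t\<rfloor> - 2 ^ n * t) / 2 ^ n"
      by (simp add: u_eq diff_divide_distrib)
    ultimately show ?thesis by (simp add: power_one_over)
  qed
  then have "(\<lambda>n. u n - t) \<longlonglongrightarrow> 0"
    by (intro Lim_null_comparison[OF always_eventually LIMSEQ_realpow_zero[of "1 / 2"]]) auto
  then have "u \<longlonglongrightarrow> t" by (simp add: LIM_zero_iff)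
  have lim: "(\<lambda>n. H (u n)) \<longlonglongrightarrow> H t" if "continuous_on {0..1} H" for H :: "real \<Rightarrow> real"
    using continuous_on_tendsto_compose[OF that \<open>u \<longlonglongrightarrow> t\<close> t always_eventually] u dyadics_subset by blast
  show ?thesis
    using LIMSEQ_unique[OF lim[OF F]] lim[OF G] eq[OF u] by simp
qed

theorem theorem3p28:
  fixes p q :: real and f g :: "real \<Rightarrow> real"
  assumes "p > 1" and "q > 1" and "1 / p + 1 / q = 1"
    and "f \<in> energy_space p" and "g \<in> energy_space q"
  shows "fs_integrable f g
    \<and> (\<forall>N M. \<forall>t\<in>{0..1}. rs_integrable (fs_trunc N f) (fs_trunc M g) 0 t)
    \<and> ((\<lambda>(N, M). SUP t\<in>{0..1}.
          ennreal \<bar>rs_integral (fs_trunc N f) (fs_trunc M g) 0 t - fs_integral f g t\<bar>)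
        \<longlongrightarrow> 0) (sequentially \<times>\<^sub>F sequentially)"
proof -
  let ?A = "\<lambda>(N, M) t. integral {0..t} (\<lambda>s. fs_trunc N f s * haar_sum M g s)"
  let ?seq2 = "sequentially \<times>\<^sub>F sequentially :: (nat \<times> nat) filter"
  obtain F where F: "uniform_limit {0..1} ?A F ?seq2"
    using uniform_limit_fs_trunc_integral[OF assms] by blast
  have cont_trunc: "continuous_on {0..1} (fs_trunc N f)" for N
    by (rule pw_primitive_continuous[OF pw_primitive_fs_trunc])
  have "?seq2 \<noteq> bot" by (simp add: prod_filter_eq_bot)
  moreover have "\<forall>\<^sub>F x in ?seq2. continuous_on {0..1} (?A x)"
    by (intro always_eventually allI)
       (auto intro!: indefinite_integral_continuous_1 pw_primitive_times_integrable_on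
          cont_trunc pw_primitive_fs_trunc)
  ultimately have F_cont: "continuous_on {0..1} F"
    using uniform_limit_theorem[OF _ F] by blast
  have F_dyadic: "dyadic_sums f g t \<longlonglongrightarrow> F t" if t: "t \<in> dyadics" for t
  proof (rule dyadic_sums_tendsto[OF assms t])
    have "((\<lambda>x. ?A x t) \<longlongrightarrow> F t) ?seq2"
      using F t dyadics_subset by (auto intro: tendsto_uniform_limitI)
    moreover have "filterlim (\<lambda>n. (n, n)) ?seq2 sequentially"
      by (intro filterlim_Pair filterlim_ident)
    ultimately show "(\<lambda>n. integral {0..t} (\<lambda>s. fs_trunc n f s * haar_sum n g s)) \<longlonglongrightarrow> F t"
      using filterlim_compose by fastforce
  qed
  have has: "has_fs_integral f g F"
    using F_cont F_dyadic
    by (auto simp: has_fs_integral_def dyadic_integrable_def dyadic_integral_def convergent_def intro: limI[symmetric])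
  then have ex: "fs_integrable f g" by (auto simp: fs_integrable_def)
  have has': "has_fs_integral f g (fs_integral f g)"
    unfolding fs_integral_def by (rule someI[of _ F]) (rule has)
  have fs_eq: "fs_integral f g t = F t" if "t \<in> {0..1}" for t
  proof (rule continuous_eq_if_eq_on_dyadics[OF _ F_cont _ that])
    show "continuous_on {0..1} (fs_integral f g)"
      using has' by (simp only: has_fs_integral_def)
    show "fs_integral f g s = F s" if "s \<in> dyadics" for s
      using has has' that unfolding has_fs_integral_def by metis
  qed
  have rs_eq: "rs_integral (fs_trunc N f) (fs_trunc M g) 0 t = ?A (N, M) t" if "t \<in> {0..1}" for N M t
    using rs_integral_pw_primitive[OF cont_trunc pw_primitive_fs_trunc] that by simp
  have rs: "rs_integrable (fs_trunc N f) (fs_trunc M g) 0 t" if "t \<in> {0..1}" for N M t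
    unfolding rs_integrable_def
    using has_rs_integral_pw_primitive[OF cont_trunc pw_primitive_fs_trunc, of t N M g] that by auto
  have "((\<lambda>(N, M). SUP t\<in>{0..1}.
          ennreal \<bar>rs_integral (fs_trunc N f) (fs_trunc M g) 0 t - fs_integral f g t\<bar>)
        \<longlongrightarrow> 0) ?seq2"
  proof (rule order_tendstoI)
    fix a :: ennreal assume "0 < a"
    then obtain b where b: "0 < b" "b < a" using dense by blast
    then obtain e where e: "b = ennreal e" "e > 0"
      by (cases b) (auto simp: top_unique dest: less_trans)
    have "\<forall>\<^sub>F x in ?seq2. \<forall>t\<in>{0..1}. dist (?A x t) (F t) < e"
      using F \<open>e > 0\<close> by (auto simp: uniform_limit_iff)
    then show "\<forall>\<^sub>F x in ?seq2. (case x of (N, M) \<Rightarrow> SUP t\<in>{0..1}.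
          ennreal \<bar>rs_integral (fs_trunc N f) (fs_trunc M g) 0 t - fs_integral f g t\<bar>) < a"
    proof (rule eventually_mono)
      fix x assume close: "\<forall>t\<in>{0..1}. dist (?A x t) (F t) < e"
      obtain N M where x: "x = (N, M)" by (cases x)
      have "(SUP t\<in>{0..1}. ennreal \<bar>rs_integral (fs_trunc N f) (fs_trunc M g) 0 t - fs_integral f g t\<bar>) \<le> b"
      proof (rule SUP_least)
        fix t :: real assume t: "t \<in> {0..1}"
        show "ennreal \<bar>rs_integral (fs_trunc N f) (fs_trunc M g) 0 t - fs_integral f g t\<bar> \<le> b"
          unfolding rs_eq[OF t] fs_eq[OF t] e(1)
          using close t by (intro ennreal_leI) (auto simp: x dist_real_def intro: less_imp_le)
      qed
      then show "(case x of (N, M) \<Rightarrow> SUP t\<in>{0..1}.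
          ennreal \<bar>rs_integral (fs_trunc N f) (fs_trunc M g) 0 t - fs_integral f g t\<bar>) < a"
        using b(2) by (simp add: x)
    qed
  qed simp
  with ex rs show ?thesis by blast
qed

end
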